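(* Let $\epsilon_n\to0^+$ and let $u_n$ be solutions of $$-\epsilon_n(\phi_p(\epsilon_n u'))'+a(x)W'(u)=0\ \text{ on }[0,1],\qquad u'(0)=0=u'(1),$$ whose energies $$E_n(x)=-\frac{1}{a(x)}\mathcal L(\epsilon_n u_n'(x))+W(u_n(x)),\qquad x\in[0,1],$$ converge uniformly on $[0,1]$ to some limit $E$. Let $Z$ be the set of accumulations of zeros of $u_n$, that is, $$Z=\bigcap_{n=1}^\infty\overline{\bigcup_{j=n}^\infty\{x\in[0,1]:u_j(x)=0\}}.$$ Then $$\operatorname{supp}E\subset Z\subset\operatorname{supp}E\cup\{x\in[0,1]:a'(x)=0\}\cup\{0,1\}.$$
   Context: Fix $p>1$, $\phi_p(s)=|s|^{p-2}s$ (with $\phi_p(0)=0$), $p^*=p/(p-1)$, $\mathcal L(s)=\frac{1}{p^*}|s|^p$. The weight $a\in C^1([0,1])$ satisfies $a(x)>0$ for all $x\in[0,1]$. The potential $W:[-1,1]\to\mathbb R$ is of class $C^1$ and satisfies: (W1) there are constants $C_{-1},C_0,C_1,W_0>0$ with $W(u)=\frac{C_{\pm1}}{p}|u-(\pm1)|^p+o(|u-(\pm1)|^p)$ as $u\to\pm1$, and $W(u)=W_0-\frac{C_0}{p}|u|^p+o(|u|^p)$ as $u\to0$; (W2) the function $u\mapsto W'(u)/\phi_p(u)$ on $[-1,1]\setminus\{0\}$ is strictly decreasing on $[-1,0)$ and strictly increasing on $(0,1]$. A solution of the boundary value problem is a function $u\in C^1([0,1])$ with values in $[-1,1]$, with $u'(0)=u'(1)=0$,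 such that $\phi_p(u')\in C^1([0,1])$ and the equation holds for every $x\in[0,1]$. $\operatorname{supp}E$ is the closure of $\{x\in[0,1]:E(x)\ne0\}$. *)

theory Defs
  imports "HOL-Analysis.Analysis" "HOL-Library.Landau_Symbols"
begin

text \<open>Functions on a compact interval \<open>S\<close> are total functions of which only the values on \<open>S\<close>
  matter; derivatives are taken within \<open>S\<close>, hence are one-sided at its endpoints.\<close>

definition deriv_within :: "real set \<Rightarrow> (real \<Rightarrow> real) \<Rightarrow> real \<Rightarrow> real" where
  "deriv_within S f x = vector_derivative f (at x within S)"

definition C1_on :: "real set \<Rightarrow> (real \<Rightarrow> real) \<Rightarrow> bool" where
  "C1_on S f \<longleftrightarrow> f differentiable_on S \<and> continuous_on S (deriv_within S f)"

text \<open>At \<open>s = 0\<close> this gives \<open>0\<close> for every \<open>p\<close>, since \<open>0 powr y = 0\<close>.\<close>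

definition phi :: "real \<Rightarrow> real \<Rightarrow> real" where
  "phi p s = \<bar>s\<bar> powr (p - 2) * s"

definition conj_exponent :: "real \<Rightarrow> real" where
  "conj_exponent p = p / (p - 1)"

definition kinetic :: "real \<Rightarrow> real \<Rightarrow> real" where
  "kinetic p s = 1 / conj_exponent p * \<bar>s\<bar> powr p"

text \<open>The little-o conditions do not constrain the values at the points \<open>-1\<close>, \<open>0\<close>, \<open>1\<close>
  themselves; for continuous \<open>W\<close> they force \<open>W (-1) = W 1 = 0\<close> and \<open>W 0 = W0\<close>.\<close>

definition W1 :: "real \<Rightarrow> (real \<Rightarrow> real) \<Rightarrow> bool" where
  "W1 p W \<longleftrightarrow> (\<exists>Cm1 C0 C1 W0 :: real. Cm1 > 0 \<and> C0 > 0 \<and> C1 > 0 \<and> W0 > 0 \<and>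
     (\<lambda>u. W u - Cm1 / p * \<bar>u - (-1)\<bar> powr p)
        \<in> o[at (-1) within {-1..1}](\<lambda>u. \<bar>u - (-1)\<bar> powr p) \<and>
     (\<lambda>u. W u - C1 / p * \<bar>u - 1\<bar> powr p)
        \<in> o[at 1 within {-1..1}](\<lambda>u. \<bar>u - 1\<bar> powr p) \<and>
     (\<lambda>u. W u - (W0 - C0 / p * \<bar>u\<bar> powr p))
        \<in> o[at 0 within {-1..1}](\<lambda>u. \<bar>u\<bar> powr p))"

definition W2 :: "real \<Rightarrow> (real \<Rightarrow> real) \<Rightarrow> bool" where
  "W2 p W \<longleftrightarrow>
     strict_antimono_on {-1..<0} (\<lambda>u. deriv_within {-1..1} W u / phi p u) \<and>
     strict_mono_on {0<..1} (\<lambda>u. deriv_within {-1..1} W u / phi p u)"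

definition is_solution ::
  "real \<Rightarrow> (real \<Rightarrow> real) \<Rightarrow> (real \<Rightarrow> real) \<Rightarrow> real \<Rightarrow> (real \<Rightarrow> real) \<Rightarrow> bool" where
  "is_solution p a W \<epsilon> u \<longleftrightarrow>
     C1_on {0..1} u \<and> u ` {0..1} \<subseteq> {-1..1} \<and>
     deriv_within {0..1} u 0 = 0 \<and> deriv_within {0..1} u 1 = 0 \<and>
     C1_on {0..1} (\<lambda>x. phi p (deriv_within {0..1} u x)) \<and>
     (\<forall>x\<in>{0..1}.
        - \<epsilon> * deriv_within {0..1} (\<lambda>t. phi p (\<epsilon> * deriv_within {0..1} u t)) x
          + a x * deriv_within {-1..1} W (u x) = 0)"

definition energy ::
  "real \<Rightarrow> (real \<Rightarrow> real) \<Rightarrow> (real \<Rightarrow> real) \<Rightarrow> real \<Rightarrow> (real \<Rightarrow> real) \<Rightarrow> real \<Rightarrow> real" where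
  "energy p a W \<epsilon> u x =
     - (1 / a x) * kinetic p (\<epsilon> * deriv_within {0..1} u x) + W (u x)"

definition supp :: "(real \<Rightarrow> real) \<Rightarrow> real set" where
  "supp E = closure {x \<in> {0..1}. E x \<noteq> 0}"

definition zero_accumulations :: "(nat \<Rightarrow> real \<Rightarrow> real) \<Rightarrow> real set" where
  "zero_accumulations u = (\<Inter>n. closure (\<Union>j\<in>{n..}. {x \<in> {0..1}. u j x = 0}))"

end

theory Submission
  imports Defs
begin

text \<open>Write \<open>v = \<epsilon> u'\<close>. The equation says \<open>\<epsilon> (\<phi>(v))' = a W'(u)\<close>, and differentiating the energy leaves
  only the term coming from the weight: \<open>E' = a' / a\<^sup>2 \<cdot> L(v)\<close>, where \<open>L(v) = a (W(u) - E)\<close> is the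
  kinetic term. Two consequences of (W1) and (W2) carry the proof: the growth
  \<open>W(u) \<ge> c (1 - |u|)\<^sup>p\<close> away from the wells (\<open>well_growth\<close>), and a force towards the nearest well with
  \<open>- u W'(u) (1 - |u|) \<ge> |u|\<^sup>p W(u)\<close> (\<open>well_pull\<close>).

  Suppose the limit energy is nonzero near a point. Where \<open>E\<^sub>n \<le> - h\<close>, the speed \<open>|v|\<close> is bounded below,
  so \<open>u\<^sub>n\<close>, which moves in \<open>[-1, 1]\<close>, can do this only on an interval of length \<open>O(\<epsilon>)\<close>. Where
  \<open>E\<^sub>n \<ge> h\<close>, the solution stays away from the wells, \<open>|u\<^sub>n|\<close> is concave between zeros and satisfies
  \<open>- \<epsilon> (\<phi>(v))' \<ge> \<kappa> \<phi>(u)\<close> there, which again limits an interval without zeros to length \<open>O(\<epsilon>)\<close>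
  (\<open>positive_solution_short\<close>). Hence zeros accumulate at every point where the limit is nonzero.

  Conversely, suppose \<open>E\<^sub>n \<rightarrow> 0\<close> uniformly on an interval where \<open>a'\<close> has a sign, so that \<open>E\<^sub>n\<close> is monotone
  there. At a zero of \<open>u\<^sub>n\<close> the potential is maximal, so \<open>L(v)\<close> is bounded below on a surrounding layer
  of width \<open>\<sim> \<epsilon>\<close>, and \<open>E\<^sub>n\<close> changes by at least \<open>k \<epsilon>\<close> on either side of the zero. By monotonicity,
  \<open>E\<^sub>n \<le> - k \<epsilon>\<close> or \<open>E\<^sub>n \<ge> k \<epsilon>\<close> on a whole interval of fixed length to one side
  (\<open>layer_dichotomy\<close>). In the first case \<open>|u'| \<ge> c \<epsilon>\<^bsup>1/p - 1\<^esup>\<close> there, and \<open>u\<^sub>n\<close> leaves \<open>[-1, 1]\<close>.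
  In the second case the trajectory oscillates, with a slow passage by a well in each
  oscillation, and it has to be shown that the energy nevertheless grows at a definite rate. Instead of
  counting oscillations, test the equation with \<open>u E\<^bsup>-\<theta>\<^esup>\<close> where \<open>\<theta> = 1 - 1/p\<close>: up to boundary terms this
  balances \<open>\<integral> |v|\<^sup>p E\<^bsup>-\<theta>\<^esup>\<close>, which is comparable to the increment of \<open>E\<^bsup>1 - \<theta>\<^esup>\<close>, against
  \<open>\<integral> - a u W'(u) E\<^bsup>-\<theta>\<^esup>\<close>, and the two integrands together are bounded below (\<open>coercivity\<close>). So
  \<open>E\<^bsup>1 - \<theta>\<^esup>\<close> changes by a fixed amount (\<open>multiplier_estimate\<close>), which contradicts \<open>E\<^sub>n \<rightarrow> 0\<close>.
\<close>

section \<open>The nonlinearity and its derivative calculus\<close>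

lemma mvt_within:
  fixes f f' :: "real \<Rightarrow> real"
  assumes "s < t" "{s..t} \<subseteq> S"
    and "\<And>x. x \<in> {s..t} \<Longrightarrow> (f has_real_derivative f' x) (at x within S)"
  obtains \<xi> where "s < \<xi>" "\<xi> < t" "f t - f s = f' \<xi> * (t - s)"
proof -
  have "(f has_derivative (\<lambda>h. f' x * h)) (at x within {s..t})" if "s \<le> x" "x \<le> t" for x
    using has_field_derivative_subset[OF assms(3) assms(2), of x] that
    by (simp add: has_field_derivative_def)
  from mvt_simple[OF assms(1) this] show thesis
    using that by auto
qed

lemma phi_mult_self: "phi p s * s = \<bar>s\<bar> powr p"
proof (cases "s = 0")
  case False
  have "phi p s * s = \<bar>s\<bar> powr (p - 2) * \<bar>s\<bar> powr 2"
    using False by (simp add: phi_def power2_eq_square)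
  then show ?thesis
    unfolding powr_add[symmetric] by simp
qed (simp add: phi_def)

lemma abs_phi: "\<bar>phi p s\<bar> = \<bar>s\<bar> powr (p - 1)"
proof (cases "s = 0")
  case False
  have "\<bar>phi p s\<bar> = \<bar>s\<bar> powr (p - 2) * \<bar>s\<bar> powr 1"
    using False by (simp add: phi_def abs_mult)
  then show ?thesis
    unfolding powr_add[symmetric] by simp
qed (simp add: phi_def)

lemma phi_pos: "0 < s \<Longrightarrow> phi p s = s powr (p - 1)"
  using abs_phi[of p s] by (simp add: phi_def abs_mult)

lemma phi_minus: "phi p (- s) = - phi p s"
  by (simp add: phi_def)

lemma phi_scale:
  assumes "0 < e" shows "phi p (e * s) = e powr (p - 1) * phi p s"
proof -
  have "\<bar>e * s\<bar> powr (p - 2) * (e * s) = (e powr (p - 2) * e) * (\<bar>s\<bar> powr (p - 2) * s)"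
    using assms by (simp add: abs_mult powr_mult)
  also have "e powr (p - 2) * e = e powr (p - 1)"
    using phi_pos[OF assms, of p] assms by (simp add: phi_def)
  finally show ?thesis by (simp add: phi_def)
qed

lemma phi_strict_mono:
  assumes "1 < p" "s < t" shows "phi p s < phi p t"
proof -
  consider "0 < s" | "s \<le> 0" "0 \<le> t" | "t < 0" using assms by linarith
  then show ?thesis
  proof cases
    case 1
    then show ?thesis using assms by (simp add: phi_pos powr_less_mono2)
  next
    case 3
    then have "phi p (- t) < phi p (- s)"
      using assms by (simp add: phi_pos powr_less_mono2 del: phi_minus)
    then show ?thesis by (simp add: phi_minus)
  next
    case 2
    then have "phi p s \<le> 0" "0 \<le> phi p t" by (auto simp: phi_def mult_le_0_iff)
    moreover have "phi p s \<noteq> 0 \<or> phi p t \<noteq> 0"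
      using 2 assms by (auto simp: phi_def)
    ultimately show ?thesis by linarith
  qed
qed

lemma phi_conj_inverse:
  assumes "1 < p" shows "phi (conj_exponent p) (phi p s) = s"
proof -
  have *: "(p - 1) * (conj_exponent p - 1) = 1"
    using assms by (simp add: conj_exponent_def field_simps)
  have pos: "phi (conj_exponent p) (phi p s) = s" if "0 < s" for s
    using that by (simp add: phi_pos powr_powr *)
  consider "0 < s" | "s = 0" | "0 < - s" by linarith
  then show ?thesis
  proof cases
    case 3
    from pos[OF 3] show ?thesis by (simp add: phi_minus)
  qed (simp_all add: pos, simp add: phi_def)
qed

text \<open>Since \<open>q > 1\<close>, this also holds at \<open>s = 0\<close>, where the difference quotient is \<open>O(|h|\<^bsup>q - 1\<^esup>)\<close>.\<close>

lemma has_real_derivative_abs_powr: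
  assumes "1 < q"
  shows "((\<lambda>s. \<bar>s\<bar> powr q / q) has_real_derivative phi q s) (at s)"
proof -
  have pos: "((\<lambda>s. \<bar>s\<bar> powr q / q) has_real_derivative phi q s) (at s)" if "0 < s" for s
  proof -
    have "((\<lambda>s. s powr q / q) has_real_derivative phi q s) (at s)"
      using that assms by (auto intro!: derivative_eq_intros simp: phi_pos)
    moreover have "\<bar>t\<bar> powr q / q = t powr q / q" if "t \<in> {0<..}" for t
      using that by simp
    ultimately show ?thesis
      using that has_field_derivative_transform_within_open[OF _ open_greaterThan] by fastforce
  qed
  consider "0 < s" | "s = 0" | "0 < - s" by linarith
  then show ?thesis
  proof cases
    case 3
    have "((\<lambda>s. \<bar>- s\<bar> powr q / q) has_real_derivative - phi q (- s)) (at s)"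
      using DERIV_chain2[where f = "\<lambda>s. \<bar>s\<bar> powr q / q" and g = uminus and s = UNIV,
          OF pos[OF 3], of "- 1"] DERIV_minus[OF DERIV_ident, of s UNIV] by simp
    then show ?thesis by (simp add: phi_minus)
  next
    case 2
    have "((\<lambda>h. \<bar>h\<bar> powr (q - 1) / q) \<longlongrightarrow> 0 powr (q - 1) / q) (at 0)"
      using assms by (intro tendsto_intros tendsto_powr2) (auto intro: tendsto_eq_intros)
    then have "((\<lambda>h. \<bar>h\<bar> powr (q - 1) / q) \<longlongrightarrow> 0) (at 0)" using assms by simp
    moreover have "\<bar>(\<bar>h\<bar> powr q / q) / h\<bar> = \<bar>h\<bar> powr (q - 1) / q" for h :: real
      using assms by (cases "h = 0") (simp_all add: powr_diff abs_mult)
    ultimately have "((\<lambda>h. (\<bar>h\<bar> powr q / q) / h) \<longlongrightarrow> 0) (at 0)"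
      by (intro tendsto_rabs_zero_cancel[of "\<lambda>h. (\<bar>h\<bar> powr q / q) / h"]) simp
    then show ?thesis using 2 by (simp add: DERIV_def phi_def)
  qed (simp add: pos)
qed

section \<open>The two wells of the potential\<close>

text \<open>The right half of the potential, with the well at \<open>1\<close>. Dividing \<open>V'\<close> by \<open>s\<^bsup>p - 1\<^esup>\<close> gives a monotone
  function, so \<open>V'\<close> cannot become positive before \<open>1\<close>: it would stay positive, and \<open>V\<close> would reach
  \<open>V(1) = 0\<close> from below, against its growth near \<open>1\<close>. The force bound is the mean value theorem on \<open>[s, 1]\<close>, with the unknown slope
  replaced by the one at \<open>s\<close> by monotonicity; the growth bound extends from a neighbourhood of \<open>1\<close> to
  the whole interval because \<open>V\<close> decreases.\<close>

lemma half_well: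
  fixes V V' :: "real \<Rightarrow> real"
  assumes p: "1 < p"
    and der: "\<And>s. s \<in> {0..1} \<Longrightarrow> (V has_real_derivative V' s) (at s within {0..1})"
    and mono: "\<And>s t. 0 < s \<Longrightarrow> s < t \<Longrightarrow> t \<le> 1 \<Longrightarrow>
      V' s / s powr (p - 1) \<le> V' t / t powr (p - 1)"
    and V1: "V 1 = 0"
    and c: "0 < c" "0 < d" "\<And>s. s \<in> {0..1} \<Longrightarrow> 1 - s < d \<Longrightarrow> c * (1 - s) powr p \<le> V s"
  shows half_well_force: "\<And>s. 0 < s \<Longrightarrow> s < 1 \<Longrightarrow> s powr (p - 1) * V s \<le> - V' s * (1 - s)"
    and half_well_growth: "\<exists>k>0. \<forall>s\<in>{0..1}. k * (1 - s) powr p \<le> V s"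
proof -
  have nonpos: "V' s \<le> 0" if s: "0 < s" "s < 1" for s
  proof (rule ccontr)
    assume "\<not> V' s \<le> 0"
    \<comment> \<open>A point so close to the well that the lower bound on \<open>V\<close> is available.\<close>
    define t where "t = max s (1 - d / 2)"
    have t: "s \<le> t" "t < 1" "1 - t < d" using s c by (auto simp: t_def max_def)
    obtain \<xi> where \<xi>: "t < \<xi>" "\<xi> < 1" "V 1 - V t = V' \<xi> * (1 - t)"
      using mvt_within[of t 1 "{0..1}" V V'] der t s by auto
    have "0 < V' s / s powr (p - 1)" using \<open>\<not> V' s \<le> 0\<close> s by simp
    also have "\<dots> \<le> V' \<xi> / \<xi> powr (p - 1)" using mono[of s \<xi>] s t \<xi> by simp
    finally have "0 < V' \<xi>" by (simp add: zero_less_divide_iff)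
    then have "V t < 0" using \<xi> V1 t by (smt (verit) mult_pos_pos)
    moreover have "0 \<le> c * (1 - t) powr p" using c by simp
    ultimately show False using c(3)[of t] s t by simp
  qed
  show "s powr (p - 1) * V s \<le> - V' s * (1 - s)" if s: "0 < s" "s < 1" for s
  proof -
    obtain \<xi> where \<xi>: "s < \<xi>" "\<xi> < 1" "V 1 - V s = V' \<xi> * (1 - s)"
      using mvt_within[of s 1 "{0..1}" V V'] der s by auto
    have "V' s / s powr (p - 1) \<le> V' \<xi> / \<xi> powr (p - 1)" using mono[of s \<xi>] s \<xi> by simp
    also have "\<dots> \<le> V' \<xi>"
    proof -
      have "\<xi> powr (p - 1) \<le> 1" using \<xi> s p by (intro powr_le1) auto
      then have "V' \<xi> \<le> V' \<xi> * \<xi> powr (p - 1)" using nonpos[of \<xi>] \<xi> s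
          mult_left_mono_neg[of "\<xi> powr (p - 1)" 1 "V' \<xi>"] by simp
      then show ?thesis using \<xi> s by (simp add: divide_le_eq)
    qed
    finally have "V' s \<le> s powr (p - 1) * V' \<xi>" using s by (simp add: divide_le_eq mult.commute)
    then have "V' s * (1 - s) \<le> (s powr (p - 1) * V' \<xi>) * (1 - s)" using s
      by (intro mult_right_mono) auto
    also have "\<dots> = - (s powr (p - 1) * V s)" using \<xi> V1
      by (simp add: mult.assoc flip: \<xi>(3))
    finally show ?thesis by simp
  qed
  have anti: "V t \<le> V s" if st: "0 \<le> s" "s \<le> t" "t < 1" for s t
  proof (cases "s = t")
    case False
    obtain \<xi> where \<xi>: "s < \<xi>" "\<xi> < t" "V t - V s = V' \<xi> * (t - s)"
      using mvt_within[of s t "{0..1}" V V'] der st False by auto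
    then have "V t - V s \<le> 0" using nonpos[of \<xi>] st by (simp add: mult_nonpos_nonneg)
    then show ?thesis by simp
  qed simp
  define t where "t = max 0 (1 - d / 2)"
  have t: "0 \<le> t" "t < 1" "1 - t < d" using c by (auto simp: t_def)
  define k where "k = c * (1 - t) powr p"
  have "(1 - t) powr p \<le> 1" using t p by (intro powr_le1) auto
  then have k: "0 < k" "k \<le> c" "k \<le> V t" using t c unfolding k_def
    by (auto simp: mult_left_le)
  have "k * (1 - s) powr p \<le> V s" if s: "s \<in> {0..1}" for s
  proof (cases "s \<le> t")
    case True
    have "(1 - s) powr p \<le> 1" using s p by (intro powr_le1) auto
    then have "k * (1 - s) powr p \<le> k" using k by (simp add: mult_left_le)
    then show ?thesis using anti[of s t] s t True k(3) by auto
  next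
    case False
    have "k * (1 - s) powr p \<le> c * (1 - s) powr p" using k by (intro mult_right_mono) auto
    then show ?thesis using c(3)[of s] s t False by simp
  qed
  with k show "\<exists>k>0. \<forall>s\<in>{0..1}. k * (1 - s) powr p \<le> V s" by blast
qed

text \<open>The little-o condition says nothing at \<open>b\<close> itself; the value there comes from continuity.\<close>

lemma expansion_at_point:
  fixes f :: "real \<Rightarrow> real"
  assumes p: "1 < p" and f: "continuous (at b within S) f" and nt: "at b within S \<noteq> bot"
    and o: "(\<lambda>x. f x - (w + k * \<bar>x - b\<bar> powr p)) \<in> o[at b within S](\<lambda>x. \<bar>x - b\<bar> powr p)"
  shows expansion_value: "f b = w"
    and expansion_lower_bound: "0 < k \<Longrightarrow>
      \<exists>d>0. \<forall>x\<in>S. \<bar>x - b\<bar> < d \<longrightarrow> w + k / 2 * \<bar>x - b\<bar> powr p \<le> f x"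
proof -
  have z: "((\<lambda>x. \<bar>x - b\<bar> powr p) \<longlongrightarrow> 0) (at b within S)"
  proof -
    have "((\<lambda>x. \<bar>x - b\<bar> powr p) \<longlongrightarrow> \<bar>b - b\<bar> powr p) (at b within S)"
      using p by (intro tendsto_powr2 tendsto_intros) auto
    then show ?thesis by simp
  qed
  have "((\<lambda>x. f x - (w + k * \<bar>x - b\<bar> powr p)) \<longlongrightarrow> 0) (at b within S)"
  proof (rule Lim_null_comparison[OF _ z])
    show "eventually (\<lambda>x. norm (f x - (w + k * \<bar>x - b\<bar> powr p)) \<le> \<bar>x - b\<bar> powr p) (at b within S)"
      using landau_o.smallD[OF o, of 1] by simp
  qed
  from tendsto_add[OF this tendsto_add[OF tendsto_const[of w] tendsto_mult[OF tendsto_const[of k] z]]]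
  have "(f \<longlongrightarrow> w) (at b within S)" by simp
  moreover have "(f \<longlongrightarrow> f b) (at b within S)" using f by (simp add: continuous_within)
  ultimately show fb: "f b = w" using tendsto_unique[OF nt] by blast
  assume k: "0 < k"
  from landau_o.smallD[OF o, of "k / 2"] k
  have "eventually (\<lambda>x. \<bar>f x - (w + k * \<bar>x - b\<bar> powr p)\<bar> \<le> k / 2 * \<bar>x - b\<bar> powr p) (at b within S)"
    by simp
  then obtain d where d: "0 < d" "\<And>x. x \<in> S \<Longrightarrow> x \<noteq> b \<Longrightarrow> \<bar>x - b\<bar> < d \<Longrightarrow>
      \<bar>f x - (w + k * \<bar>x - b\<bar> powr p)\<bar> \<le> k / 2 * \<bar>x - b\<bar> powr p"
    by (auto simp: eventually_at dist_real_def)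
  have "w + k / 2 * \<bar>x - b\<bar> powr p \<le> f x" if "x \<in> S" "\<bar>x - b\<bar> < d" for x
  proof (cases "x = b")
    case False
    from abs_le_D2[OF d(2)[OF that(1) False that(2)]] show ?thesis by (simp add: field_simps)
  qed (simp add: fb)
  with d(1) show "\<exists>d>0. \<forall>x\<in>S. \<bar>x - b\<bar> < d \<longrightarrow> w + k / 2 * \<bar>x - b\<bar> powr p \<le> f x" by blast
qed

lemma C1_on_has_real_derivative:
  assumes "C1_on S f" "x \<in> S"
  shows "(f has_real_derivative deriv_within S f x) (at x within S)"
  using assms unfolding C1_on_def deriv_within_def differentiable_on_def
  by (simp add: has_real_derivative_iff_has_vector_derivative vector_derivative_works)

text \<open>Both halves reduce to the one-sided statement, the left one through \<open>s \<mapsto> W(- s)\<close>. The pull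
  towards the wells is multiplied out by \<open>1 - |u|\<close>, so that it holds at the wells too.\<close>

lemma double_well:
  assumes p: "1 < p" and C: "C1_on {-1..1} W" and w1: "W1 p W" and w2: "W2 p W"
  shows well_max_pos: "0 < W 0"
    and well_growth: "\<exists>c>0. \<forall>u\<in>{-1..1}. c * (1 - \<bar>u\<bar>) powr p \<le> W u"
    and well_pull: "\<And>u. u \<in> {-1..1} \<Longrightarrow>
      \<bar>u\<bar> powr p * W u \<le> - deriv_within {-1..1} W u * u * (1 - \<bar>u\<bar>)"
proof -
  define D where "D = deriv_within {-1..1} W"
  have der: "(W has_real_derivative D u) (at u within {-1..1})" if "u \<in> {-1..1}" for u
    unfolding D_def using C1_on_has_real_derivative[OF C that] .
  have cont: "continuous (at u within {-1..1}) W" if "u \<in> {-1..1}" for u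
    using der[OF that] by (rule DERIV_continuous)
  have nt: "at u within {-1..1::real} \<noteq> bot" if "u \<in> {-1..1}" for u
    using that by (simp add: trivial_limit_within islimpt_Icc)
  from w1 obtain Cm1 C0 C1 W0 where K: "Cm1 > 0" "C0 > 0" "C1 > 0" "W0 > 0" and
     o1: "(\<lambda>u. W u - Cm1 / p * \<bar>u - (-1)\<bar> powr p)
        \<in> o[at (-1) within {-1..1}](\<lambda>u. \<bar>u - (-1)\<bar> powr p)" and
     o2: "(\<lambda>u. W u - C1 / p * \<bar>u - 1\<bar> powr p)
        \<in> o[at 1 within {-1..1}](\<lambda>u. \<bar>u - 1\<bar> powr p)" and
     o3: "(\<lambda>u. W u - (W0 - C0 / p * \<bar>u\<bar> powr p))
        \<in> o[at 0 within {-1..1}](\<lambda>u. \<bar>u\<bar> powr p)"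
    unfolding W1_def by blast
  show "0 < W 0"
    using expansion_value[OF p cont nt, of 0 W0 "- C0 / p"] o3 K by simp
  note at1 = expansion_value[OF p cont nt, of 1 0 "C1 / p"]
    expansion_lower_bound[OF p cont nt, of 1 0 "C1 / p"]
  note atm1 = expansion_value[OF p cont nt, of "-1" 0 "Cm1 / p"]
    expansion_lower_bound[OF p cont nt, of "-1" 0 "Cm1 / p"]
  have v1: "W 1 = 0" "W (- 1) = 0" using at1(1) atm1(1) o1 o2 by auto
  obtain d where d: "0 < d" "\<And>u. u \<in> {-1..1} \<Longrightarrow> \<bar>u - 1\<bar> < d \<Longrightarrow> C1 / p / 2 * \<bar>u - 1\<bar> powr p \<le> W u"
    using at1(2) o2 K p by auto
  obtain d' where d': "0 < d'" "\<And>u. u \<in> {-1..1} \<Longrightarrow> \<bar>u + 1\<bar> < d' \<Longrightarrow> Cm1 / p / 2 * \<bar>u + 1\<bar> powr p \<le> W u"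
    using atm1(2) o1 K p by auto
  have r1: "(W has_real_derivative D s) (at s within {0..1})" if "s \<in> {0..1}" for s
    using has_field_derivative_subset[OF der] that by fastforce
  have r2: "D s / s powr (p - 1) \<le> D t / t powr (p - 1)" if "0 < s" "s < t" "t \<le> 1" for s t
  proof -
    have "D s / phi p s < D t / phi p t"
      using w2 that unfolding W2_def D_def[symmetric] monotone_on_def by auto
    then show ?thesis using that by (simp add: phi_pos)
  qed
  have r3: "C1 / p / 2 * (1 - s) powr p \<le> W s" if "s \<in> {0..1}" "1 - s < d" for s
  proof -
    have "\<bar>s - 1\<bar> = 1 - s" using that by simp
    then show ?thesis using d(2)[of s] that by auto
  qed
  have l1: "((\<lambda>s. W (- s)) has_real_derivative - D (- s)) (at s within {0..1})" if "s \<in> {0..1}" for s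
  proof -
    have "((W \<circ> uminus) has_real_derivative D (- s) * (- 1)) (at s within {0..1})"
      using that by (intro DERIV_image_chain has_field_derivative_subset[OF der])
        (auto intro!: derivative_eq_intros)
    then show ?thesis by (simp add: o_def)
  qed
  have l2: "- D (- s) / s powr (p - 1) \<le> - D (- t) / t powr (p - 1)" if st: "0 < s" "s < t" "t \<le> 1" for s t
  proof -
    have "D (- s) / phi p (- s) < D (- t) / phi p (- t)"
      using w2 st unfolding W2_def D_def[symmetric] monotone_on_def
      by auto
    then show ?thesis using st by (simp add: phi_pos phi_minus)
  qed
  have l3: "Cm1 / p / 2 * (1 - s) powr p \<le> W (- s)" if "s \<in> {0..1}" "1 - s < d'" for s
  proof -
    have "\<bar>- s + 1\<bar> = 1 - s" using that by simp
    then show ?thesis using d'(2)[of "- s"] that by auto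
  qed
  have Kp: "0 < C1 / p / 2" "0 < Cm1 / p / 2" using K p by auto
  have R: "s powr (p - 1) * W s \<le> - D s * (1 - s)" if "0 < s" "s < 1" for s
    by (rule half_well_force[where V = W and V' = D, OF p _ _ v1(1) Kp(1) d(1) _ that]) (rule r1 r2 r3; assumption)+
  have L: "s powr (p - 1) * W (- s) \<le> - (- D (- s)) * (1 - s)" if "0 < s" "s < 1" for s
    by (rule half_well_force[where V = "\<lambda>s. W (- s)" and V' = "\<lambda>s. - D (- s)", OF p _ _ v1(2) Kp(2) d'(1) _ that])
      (rule l1 l2 l3; assumption)+
  obtain k where k: "k > 0" "\<And>s. s \<in> {0..1} \<Longrightarrow> k * (1 - s) powr p \<le> W s"
  proof -
    have "\<exists>k>0. \<forall>s\<in>{0..1}. k * (1 - s) powr p \<le> W s"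
      by (rule half_well_growth[where V = W and V' = D, OF p _ _ v1(1) Kp(1) d(1)]) (rule r1 r2 r3; assumption)+
    then show thesis using that by blast
  qed
  obtain k' where k': "k' > 0" "\<And>s. s \<in> {0..1} \<Longrightarrow> k' * (1 - s) powr p \<le> W (- s)"
  proof -
    have "\<exists>k>0. \<forall>s\<in>{0..1}. k * (1 - s) powr p \<le> W (- s)"
      by (rule half_well_growth[where V = "\<lambda>s. W (- s)" and V' = "\<lambda>s. - D (- s)", OF p _ _ v1(2) Kp(2) d'(1)])
        (rule l1 l2 l3; assumption)+
    then show thesis using that by blast
  qed
  have "min k k' * (1 - \<bar>u\<bar>) powr p \<le> W u" if u: "u \<in> {-1..1}" for u
  proof -
    have "min k k' * (1 - \<bar>u\<bar>) powr p \<le> (if 0 \<le> u then k else k') * (1 - \<bar>u\<bar>) powr p"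
      by (intro mult_right_mono) auto
    also have "\<dots> \<le> W u" using k(2)[of u] k'(2)[of "- u"] u by auto
    finally show ?thesis .
  qed
  moreover have "0 < min k k'" using k k' by simp
  ultimately show "\<exists>c>0. \<forall>u\<in>{-1..1}. c * (1 - \<bar>u\<bar>) powr p \<le> W u" by blast
  fix u :: real assume u: "u \<in> {-1..1}"
  have split: "\<bar>u\<bar> powr p = \<bar>u\<bar> * \<bar>u\<bar> powr (p - 1)"
    using powr_add[of "\<bar>u\<bar>" 1 "p - 1"] by simp
  consider "u = 0" | "u = 1" | "u = -1" | "0 < u" "u < 1" | "0 < - u" "- u < 1" using u by fastforce
  then show "\<bar>u\<bar> powr p * W u \<le> - deriv_within {-1..1} W u * u * (1 - \<bar>u\<bar>)"
  proof cases
    case 4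
    from mult_left_mono[OF R[OF 4], of u] show ?thesis
      using 4 unfolding split D_def by (simp add: algebra_simps)
  next
    case 5
    from mult_left_mono[OF L[OF 5], of "- u"] show ?thesis
      using 5 unfolding split D_def by (simp add: algebra_simps)
  qed (auto simp: v1)
qed

section \<open>Estimates along a single trajectory\<close>

text \<open>By the mean value theorem \<open>u\<close> moves by at least \<open>\<eta> (t - s) / e\<close>, and it has only room \<open>2\<close>.\<close>

lemma fast_motion:
  fixes u v :: "real \<Rightarrow> real"
  assumes "s < t" "{s..t} \<subseteq> S" "0 < e"
    and u: "\<And>x. x \<in> {s..t} \<Longrightarrow> (u has_real_derivative v x / e) (at x within S)"
    and bnd: "\<And>x. x \<in> {s..t} \<Longrightarrow> \<bar>u x\<bar> \<le> 1"
    and v: "\<And>x. x \<in> {s..t} \<Longrightarrow> \<eta> \<le> \<bar>v x\<bar>"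
  shows "\<eta> * (t - s) \<le> 2 * e"
proof -
  obtain \<xi> where \<xi>: "s < \<xi>" "\<xi> < t" "u t - u s = v \<xi> / e * (t - s)"
    using mvt_within[OF assms(1,2), of u "\<lambda>x. v x / e"] u by blast
  have "\<eta> * (t - s) \<le> \<bar>v \<xi>\<bar> * (t - s)"
    using v[of \<xi>] \<xi> by (intro mult_right_mono) auto
  also have "\<dots> = e * \<bar>u t - u s\<bar>"
    using \<xi> assms by (simp add: abs_mult)
  also have "\<dots> \<le> e * 2"
  proof (intro mult_left_mono)
    show "\<bar>u t - u s\<bar> \<le> 2" using bnd[of s] bnd[of t] assms(1) by (simp add: abs_le_iff)
  qed (use assms in simp)
  finally show ?thesis by simp
qed

text \<open>A comparison argument of Sturm type. The flux \<open>\<phi>(v)\<close> decreases, so \<open>u\<close> is concave. If \<open>M\<close> is the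
  maximum of \<open>u\<close> and \<open>l\<close> a third of the length, concavity gives \<open>u \<ge> M / 3\<close> and \<open>|v| \<le> e M / l\<close> on the
  middle third, so the flux drops there by at least \<open>\<kappa> (M / 3)\<^bsup>p - 1\<^esup> l / e\<close> and at most
  \<open>2 (e M / l)\<^bsup>p - 1\<^esup>\<close>. Both sides have the same homogeneity in \<open>M\<close>, so the resulting bound on \<open>l\<close> does not
  depend on how small \<open>u\<close> is.\<close>

lemma positive_solution_short:
  fixes u v f :: "real \<Rightarrow> real"
  assumes p: "1 < p" and st: "s < t" "{s..t} \<subseteq> S" and e: "0 < e" and \<kappa>: "0 < \<kappa>"
    and u: "\<And>x. x \<in> {s..t} \<Longrightarrow> (u has_real_derivative v x / e) (at x within S)"
    and g: "\<And>x. x \<in> {s..t} \<Longrightarrow> ((\<lambda>x. phi p (v x)) has_real_derivative f x / e) (at x within S)"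
    and pos: "\<And>x. x \<in> {s..t} \<Longrightarrow> 0 < u x"
    and f: "\<And>x. x \<in> {s..t} \<Longrightarrow> f x \<le> - \<kappa> * u x powr (p - 1)"
  shows "\<kappa> * ((t - s) / 3) powr p \<le> 2 * 3 powr (p - 1) * e powr p"
proof -
  define l where "l = (t - s) / 3"
  have l: "0 < l" using st by (simp add: l_def)
  have mvu: "\<exists>\<xi>. x < \<xi> \<and> \<xi> < y \<and> u y - u x = v \<xi> / e * (y - x)"
    if "s \<le> x" "x < y" "y \<le> t" for x y
    using mvt_within[of x y S u "\<lambda>x. v x / e"] u st that by (smt (verit) atLeastAtMost_iff subset_iff)
  have mvg: "\<exists>\<xi>. x < \<xi> \<and> \<xi> < y \<and> phi p (v y) - phi p (v x) = f \<xi> / e * (y - x)"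
    if "s \<le> x" "x < y" "y \<le> t" for x y
    using mvt_within[of x y S "\<lambda>x. phi p (v x)" "\<lambda>x. f x / e"] g st that
    by (smt (verit) atLeastAtMost_iff subset_iff)
  have fneg: "f x \<le> 0" if "x \<in> {s..t}" for x
  proof -
    have "0 \<le> \<kappa> * u x powr (p - 1)" using \<kappa> by simp
    then show ?thesis using f[OF that] by simp
  qed
  have anti: "v y \<le> v x" if xy: "s \<le> x" "x < y" "y \<le> t" for x y
  proof (rule ccontr)
    assume "\<not> v y \<le> v x"
    then have "phi p (v x) < phi p (v y)" using p by (intro phi_strict_mono) auto
    moreover obtain \<xi> where "x < \<xi>" "\<xi> < y" "phi p (v y) - phi p (v x) = f \<xi> / e * (y - x)"
      using mvg[OF xy] by blast
    moreover have "f \<xi> / e * (y - x) \<le> 0"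
      using fneg[of \<xi>] calculation xy e by (intro mult_nonpos_nonneg divide_nonpos_pos) auto
    ultimately show False by linarith
  qed
  \<comment> \<open>Concavity of \<open>u\<close>, as a comparison of secant slopes with denominators cleared.\<close>
  have secant: "(u b - u x) * (x - a) \<le> (u x - u a) * (b - x)" if ab: "s \<le> a" "a < x" "x < b" "b \<le> t" for a x b
  proof -
    obtain \<xi> where \<xi>: "x < \<xi>" "\<xi> < b" "u b - u x = v \<xi> / e * (b - x)" using mvu[of x b] ab by auto
    obtain \<zeta> where \<zeta>: "a < \<zeta>" "\<zeta> < x" "u x - u a = v \<zeta> / e * (x - a)" using mvu[of a x] ab by auto
    have "v \<xi> / e * ((b - x) * (x - a)) \<le> v \<zeta> / e * ((b - x) * (x - a))"
      using anti[of \<zeta> \<xi>] \<xi> \<zeta> ab e by (intro mult_right_mono divide_right_mono) auto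
    then show ?thesis unfolding \<xi>(3) \<zeta>(3) by (simp add: mult_ac)
  qed
  have "continuous_on {s..t} u"
    using st(2) by (intro DERIV_continuous_on[of _ _ "\<lambda>x. v x / e"])
      (auto intro: has_field_derivative_subset[OF u])
  then obtain m where m: "m \<in> {s..t}" "\<And>y. y \<in> {s..t} \<Longrightarrow> u y \<le> u m"
    using continuous_attains_sup[of "{s..t}" u] st by auto
  define M where "M = u m"
  have M: "0 < M" using pos m by (simp add: M_def)
  define s1 t1 where "s1 = s + l" and "t1 = t - l"
  have st1: "s < s1" "s1 < t1" "t1 < t" "t1 - s1 = l" "t - s = 3 * l"
    using l by (auto simp: s1_def t1_def l_def field_simps)
  have low: "M / 3 \<le> u x" if x: "x \<in> {s1..t1}" for x
  proof -
    have ux: "0 < u x" "u x \<le> M" using x st1 pos[of x] m(2)[of x] by (auto simp: M_def)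
    consider "x < m" | "x = m" | "m < x" by linarith
    then have "(M - u x) * l \<le> u x * (2 * l)"
    proof cases
      case 1
      have "(M - u x) * l \<le> (M - u x) * (x - s)"
        using ux x by (intro mult_left_mono) (auto simp: s1_def)
      also have "\<dots> \<le> (u x - u s) * (m - x)"
        using secant[of s x m] 1 x st1 m by (auto simp: M_def)
      also have "\<dots> \<le> u x * (m - x)"
        using pos[of s] st 1 by (intro mult_right_mono) auto
      also have "\<dots> \<le> u x * (2 * l)"
        using ux m x st1 by (intro mult_left_mono) (auto simp: s1_def)
      finally show ?thesis .
    next
      case 3
      have "(M - u x) * l \<le> (M - u x) * (t - x)"
        using ux x by (intro mult_left_mono) (auto simp: t1_def)
      also have "\<dots> \<le> (u x - u t) * (x - m)"
        using secant[of m x t] 3 x st1 m by (auto simp: M_def algebra_simps)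
      also have "\<dots> \<le> u x * (x - m)"
        using pos[of t] st 3 by (intro mult_right_mono) auto
      also have "\<dots> \<le> u x * (2 * l)"
        using ux m x st1 by (intro mult_left_mono) (auto simp: t1_def)
      finally show ?thesis .
    qed (use l ux in \<open>auto simp: M_def\<close>)
    then have "(M - u x) * l \<le> (2 * u x) * l" by simp
    then show ?thesis using l by (simp only: mult_le_cancel_right) auto
  qed
  have "v s1 * l \<le> e * M"
  proof -
    obtain \<xi> where \<xi>: "s < \<xi>" "\<xi> < s1" "u s1 - u s = v \<xi> / e * (s1 - s)" using mvu[of s s1] st1 by auto
    have "v s1 * l \<le> v \<xi> * l" using anti[of \<xi> s1] \<xi> st1 l by (intro mult_right_mono) auto
    also have "\<dots> = e * (u s1 - u s)" using \<xi>(3) e by (simp add: s1_def)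
    also have "\<dots> \<le> e * M" using pos[of s] m(2)[of s1] st1 e st by (intro mult_left_mono) (auto simp: M_def)
    finally show ?thesis .
  qed
  then have "v s1 \<le> e * M / l" using l by (simp add: pos_le_divide_eq)
  have "- v t1 * l \<le> e * M"
  proof -
    obtain \<xi> where \<xi>: "t1 < \<xi>" "\<xi> < t" "u t - u t1 = v \<xi> / e * (t - t1)" using mvu[of t1 t] st1 by auto
    have "- v t1 * l \<le> - v \<xi> * l" using anti[of t1 \<xi>] \<xi> st1 l by (intro mult_right_mono) auto
    also have "\<dots> = e * (u t1 - u t)" using \<xi>(3) e by (simp add: t1_def algebra_simps)
    also have "\<dots> \<le> e * M" using pos[of t] m(2)[of t1] st1 e st by (intro mult_left_mono) (auto simp: M_def)
    finally show ?thesis .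
  qed
  then have "- v t1 \<le> e * M / l" using l by (simp add: pos_le_divide_eq)
  have mono: "phi p x \<le> phi p y" if "x \<le> y" for x y
    using phi_strict_mono[OF p, of x y] that by (cases "x = y") auto
  define G where "G = (e * M / l) powr (p - 1)"
  have G: "G = phi p (e * M / l)" using e M l by (simp add: G_def phi_pos)
  have "phi p (v s1) \<le> G" "- phi p (v t1) \<le> G"
    using mono[OF \<open>v s1 \<le> e * M / l\<close>] mono[OF \<open>- v t1 \<le> e * M / l\<close>] by (auto simp: G phi_minus)
  moreover obtain \<xi> where \<xi>: "s1 < \<xi>" "\<xi> < t1" "phi p (v t1) - phi p (v s1) = f \<xi> / e * (t1 - s1)"
    using mvg[of s1 t1] st1 by auto
  ultimately have "- (f \<xi> / e * l) \<le> 2 * G" using st1 by simp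
  then have "- f \<xi> * l \<le> 2 * e * G" using e by (simp add: field_simps)
  moreover have "\<kappa> * (M / 3) powr (p - 1) * l \<le> - f \<xi> * l"
  proof (intro mult_right_mono)
    have "\<kappa> * (M / 3) powr (p - 1) \<le> \<kappa> * u \<xi> powr (p - 1)"
      using low[of \<xi>] \<xi> M \<kappa> p by (intro mult_left_mono powr_mono2) auto
    then show "\<kappa> * (M / 3) powr (p - 1) \<le> - f \<xi>" using f[of \<xi>] \<xi> st1 by simp
  qed (use l in simp)
  ultimately have "\<kappa> * (M / 3) powr (p - 1) * l \<le> 2 * e * G" by linarith
  then have "\<kappa> * (M powr (p - 1) / 3 powr (p - 1)) * l
      \<le> 2 * e * (e powr (p - 1) * M powr (p - 1) / l powr (p - 1))"
    using e M l by (simp add: G_def powr_divide powr_mult)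
  then have "\<kappa> * (l * l powr (p - 1)) * M powr (p - 1)
      \<le> 2 * 3 powr (p - 1) * (e * e powr (p - 1)) * M powr (p - 1)"
    using l by (simp add: field_simps)
  then have "\<kappa> * (l * l powr (p - 1)) \<le> 2 * 3 powr (p - 1) * (e * e powr (p - 1))"
    using M by simp
  moreover have "x * x powr (p - 1) = x powr p" if "0 < x" for x
    using powr_add[of x 1 "p - 1"] that by simp
  ultimately show ?thesis unfolding l_def[symmetric] using l e by simp
qed

text \<open>The function \<open>e \<phi>(v) u\<close> has derivative \<open>|v|\<^sup>p + f u\<close>, while the coercivity hypothesis concerns
  \<open>|v|\<^sup>p - f u\<close>. The difference \<open>2 |v|\<^sup>p\<close> is paid for by the growth of the energy: in
  \<open>H = \<sigma> A E\<^bsup>1 - \<theta>\<^esup> - e \<phi>(v) u E\<^bsup>- \<theta>\<^esup>\<close> the constant \<open>A\<close> is large enough that the first term also absorbs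
  the derivative of the weight \<open>E\<^bsup>- \<theta>\<^esup>\<close>, which is where \<open>E \<ge> k e\<close> enters. Then \<open>H' \<ge> c\<close>, whereas \<open>H\<close> is small
  at both ends when \<open>e\<close> and \<open>E\<close> are.\<close>

lemma multiplier_estimate:
  fixes u v f E E' :: "real \<Rightarrow> real"
  assumes st: "s < t" "{s..t} \<subseteq> S" and e: "0 < e" and \<theta>: "0 < \<theta>" "\<theta> < 1"
    and m: "0 < m" and k: "0 < k" and B: "0 \<le> B" and \<sigma>: "\<bar>\<sigma>\<bar> = 1"
    and u: "\<And>x. x \<in> {s..t} \<Longrightarrow> (u has_real_derivative v x / e) (at x within S)"
    and g: "\<And>x. x \<in> {s..t} \<Longrightarrow> ((\<lambda>x. phi p (v x)) has_real_derivative f x / e) (at x within S)"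
    and E: "\<And>x. x \<in> {s..t} \<Longrightarrow> (E has_real_derivative E' x) (at x within S)"
    and grow: "\<And>x. x \<in> {s..t} \<Longrightarrow> m * \<bar>v x\<bar> powr p \<le> \<sigma> * E' x"
    and El: "\<And>x. x \<in> {s..t} \<Longrightarrow> k * e \<le> E x" and Eu: "\<And>x. x \<in> {s..t} \<Longrightarrow> E x \<le> h"
    and bnd: "\<And>x. x \<in> {s..t} \<Longrightarrow> \<bar>phi p (v x) * u x\<bar> \<le> B"
    and coer: "\<And>x. x \<in> {s..t} \<Longrightarrow> c * E x powr \<theta> \<le> \<bar>v x\<bar> powr p - f x * u x"
  shows "c * (t - s) \<le> (2 / m + \<theta> * B / k) / (1 - \<theta>) * h powr (1 - \<theta>)
      + 2 * B * k powr (- \<theta>) * e powr (1 - \<theta>)"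
proof -
  define A where "A = (2 / m + \<theta> * B / k) / (1 - \<theta>)"
  have A: "0 \<le> A" "A * (1 - \<theta>) = 2 / m + \<theta> * B / k"
    using m \<theta> B k by (auto simp: A_def)
  define H where "H x = \<sigma> * A * E x powr (1 - \<theta>) - e * (phi p (v x) * u x * E x powr (- \<theta>))" for x
  define H' where "H' x = \<sigma> * A * ((1 - \<theta>) * E x powr (1 - \<theta> - 1) * E' x)
    - e * ((f x / e * u x + phi p (v x) * (v x / e)) * E x powr (- \<theta>)
        + phi p (v x) * u x * (- \<theta> * E x powr (- \<theta> - 1) * E' x))" for x
  have Epos: "0 < E x" if "x \<in> {s..t}" for x
    using El[OF that] k e by (smt (verit) mult_pos_pos)
  have Epow: "((\<lambda>x. E x powr r) has_real_derivative r * E x powr (r - 1) * E' x) (at x within S)"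
    if "x \<in> {s..t}" for x r
    by (rule DERIV_chain2[OF has_real_derivative_powr[OF Epos[OF that]] E[OF that]])
  have H: "(H has_real_derivative H' x) (at x within S)" if x: "x \<in> {s..t}" for x
  proof -
    have "((\<lambda>x. phi p (v x) * u x * E x powr (- \<theta>)) has_real_derivative
        (f x / e * u x + phi p (v x) * (v x / e)) * E x powr (- \<theta>)
        + phi p (v x) * u x * (- \<theta> * E x powr (- \<theta> - 1) * E' x)) (at x within S)"
      using DERIV_mult[OF DERIV_mult[OF g[OF x] u[OF x]] Epow[OF x, of "- \<theta>"]]
      by (simp add: algebra_simps)
    from DERIV_diff[OF DERIV_cmult[OF Epow[OF x, of "1 - \<theta>"], of "\<sigma> * A"] DERIV_cmult[OF this, of e]]
    show ?thesis unfolding H_def[abs_def] H'_def .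
  qed
  have ge: "c \<le> H' x" if x: "x \<in> {s..t}" for x
  proof -
    define P where "P = E x powr (- \<theta>)"
    have P: "0 < P" "E x powr \<theta> * P = 1" using Epos[OF x] by (auto simp: P_def powr_minus)
    have Q: "E x powr (- \<theta> - 1) = P / E x" using Epos[OF x] by (simp add: P_def powr_diff)
    define T where "T = \<theta> * (e / E x) * (phi p (v x) * u x) * E' x"
    have eq: "H' x = P * (A * (1 - \<theta>) * (\<sigma> * E' x) - f x * u x - \<bar>v x\<bar> powr p + T)"
      using e Epos[OF x] unfolding H'_def T_def phi_mult_self[symmetric]
      by (simp add: Q flip: P_def) (simp add: field_simps)
    have sE: "0 \<le> \<sigma> * E' x" using grow[OF x] m by (smt (verit) mult_nonneg_nonneg powr_ge_zero)
    have absE: "\<bar>E' x\<bar> = \<sigma> * E' x" using sE \<sigma> by (metis abs_mult abs_of_nonneg mult_1)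
    have "e / E x \<le> 1 / k" using El[OF x] Epos[OF x] k by (simp add: field_simps)
    then have "\<theta> * (e / E x) * \<bar>phi p (v x) * u x\<bar> * (\<sigma> * E' x) \<le> \<theta> * (1 / k) * B * (\<sigma> * E' x)"
      using \<theta> e Epos[OF x] bnd[OF x] B k by (intro mult_right_mono[OF _ sE] mult_mono) auto
    moreover have "\<bar>T\<bar> = \<theta> * (e / E x) * \<bar>phi p (v x) * u x\<bar> * (\<sigma> * E' x)"
      using \<theta> e Epos[OF x] unfolding T_def by (simp add: abs_mult flip: absE)
    ultimately have T: "- T \<le> \<theta> * (1 / k) * B * (\<sigma> * E' x)"
      using abs_ge_minus_self order_trans by metis
    have speed: "\<bar>v x\<bar> powr p \<le> \<sigma> * E' x / m" using grow[OF x] m by (simp add: field_simps)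
    have "A * (1 - \<theta>) * (\<sigma> * E' x) = 2 * (\<sigma> * E' x / m) + \<theta> * (1 / k) * B * (\<sigma> * E' x)"
      unfolding A(2) by (simp add: field_simps)
    moreover have "V - F \<le> Z - F - V + T" if "- T \<le> X" "V \<le> Y" "Z = 2 * Y + X" for V F X Y Z :: real
      using that by linarith
    ultimately have "\<bar>v x\<bar> powr p - f x * u x
      \<le> A * (1 - \<theta>) * (\<sigma> * E' x) - f x * u x - \<bar>v x\<bar> powr p + T"
      using T speed by blast
    then have "c * E x powr \<theta> \<le> A * (1 - \<theta>) * (\<sigma> * E' x) - f x * u x - \<bar>v x\<bar> powr p + T"
      using coer[OF x] by linarith
    then have "P * (c * E x powr \<theta>) \<le> H' x" unfolding eq using P by (intro mult_left_mono) auto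
    moreover have "P * (c * E x powr \<theta>) = c * (E x powr \<theta> * P)" by (simp only: mult_ac)
    ultimately show ?thesis unfolding P(2) by simp
  qed
  obtain \<xi> where \<xi>: "s < \<xi>" "\<xi> < t" "H t - H s = H' \<xi> * (t - s)"
    using mvt_within[OF st, of H H'] H by blast
  have "c * (t - s) \<le> H t - H s" unfolding \<xi>(3) using ge[of \<xi>] \<xi> by (intro mult_right_mono) auto
  also have "\<dots> = A * (\<sigma> * (E t powr (1 - \<theta>) - E s powr (1 - \<theta>)))
      + e * (phi p (v s) * u s * E s powr (- \<theta>)) - e * (phi p (v t) * u t * E t powr (- \<theta>))"
    by (simp add: H_def algebra_simps)
  also have "\<dots> \<le> A * h powr (1 - \<theta>) + B * k powr (- \<theta>) * e powr (1 - \<theta>)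
      + B * k powr (- \<theta>) * e powr (1 - \<theta>)"
  proof -
    have 1: "\<sigma> * (E t powr (1 - \<theta>) - E s powr (1 - \<theta>)) \<le> h powr (1 - \<theta>)"
    proof -
      have "\<bar>\<sigma> * (E t powr (1 - \<theta>) - E s powr (1 - \<theta>))\<bar> \<le> h powr (1 - \<theta>)"
        unfolding abs_mult \<sigma> using Epos[of t] Epos[of s] st \<theta>
          powr_mono2[OF _ _ Eu[of t], of "1 - \<theta>"] powr_mono2[OF _ _ Eu[of s], of "1 - \<theta>"]
        by (simp add: abs_le_iff) (smt (verit) powr_ge_zero)
      then show ?thesis by linarith
    qed
    have 2: "\<bar>e * (phi p (v x) * u x * E x powr (- \<theta>))\<bar> \<le> B * k powr (- \<theta>) * e powr (1 - \<theta>)"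
      if x: "x \<in> {s..t}" for x
    proof -
      have "E x powr (- \<theta>) \<le> (k * e) powr (- \<theta>)"
        using El[OF x] k e \<theta> by (intro powr_mono2') auto
      then have "\<bar>e * (phi p (v x) * u x * E x powr (- \<theta>))\<bar> \<le> e * (B * (k * e) powr (- \<theta>))"
        unfolding abs_mult using e bnd[OF x] B by (intro mult_mono) (auto simp: abs_mult)
      also have "\<dots> = B * k powr (- \<theta>) * (e * e powr (- \<theta>))"
        using k e by (simp add: powr_mult)
      also have "e * e powr (- \<theta>) = e powr (1 - \<theta>)"
        using powr_add[of e 1 "- \<theta>"] e by simp
      finally show ?thesis .
    qed
    have "A * (\<sigma> * (E t powr (1 - \<theta>) - E s powr (1 - \<theta>))) \<le> A * h powr (1 - \<theta>)"
      using 1 A by (intro mult_left_mono) auto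
    then show ?thesis using 2[of s] 2[of t] st by (auto simp: abs_le_iff)
  qed
  finally show ?thesis by (simp add: A_def)
qed

text \<open>If \<open>\<sigma> E(z) \<ge> 0\<close>, then \<open>\<sigma> E \<ge> j\<close> from \<open>z + \<rho>\<close> on; otherwise \<open>\<sigma> E \<le> - j\<close> up to \<open>z - \<rho>\<close>. Which of the
  two alternatives for \<open>E\<close> this gives depends on \<open>\<sigma>\<close>; both intervals have length at least \<open>\<delta>\<close>.\<close>

lemma layer_dichotomy:
  fixes E :: "real \<Rightarrow> real"
  assumes mono: "\<And>x y. l \<le> x \<Longrightarrow> x \<le> y \<Longrightarrow> y \<le> r \<Longrightarrow> \<sigma> * E x \<le> \<sigma> * E y" and \<sigma>: "\<bar>\<sigma>\<bar> = 1"
    and z: "l + 2 * \<delta> \<le> z" "z \<le> r - 2 * \<delta>" and \<rho>: "0 < \<rho>" "\<rho> \<le> \<delta>"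
    and jump: "\<sigma> * (E (z + \<rho>) - E z) \<ge> j" "\<sigma> * (E z - E (z - \<rho>)) \<ge> j"
  shows "\<exists>s t. l \<le> s \<and> t \<le> r \<and> \<delta> \<le> t - s \<and>
    ((\<forall>x\<in>{s..t}. j \<le> E x) \<or> (\<forall>x\<in>{s..t}. E x \<le> - j))"
proof -
  have sgn: "\<sigma> = 1 \<or> \<sigma> = -1" using \<sigma> by linarith
  show ?thesis
  proof (cases "0 \<le> \<sigma> * E z")
    case True
    have "j \<le> \<sigma> * E x" if "x \<in> {z + \<rho>..r}" for x
      using mono[of "z + \<rho>" x] that jump(1) True z \<rho> by (auto simp: right_diff_distrib)
    then show ?thesis
      using sgn z \<rho> by (intro exI[of _ "z + \<rho>"] exI[of _ r]) force
  next
    case False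
    have "\<sigma> * E x \<le> - j" if "x \<in> {l..z - \<rho>}" for x
      using mono[of x "z - \<rho>"] that jump(2) False z \<rho> by (auto simp: right_diff_distrib)
    then show ?thesis
      using sgn z \<rho> by (intro exI[of _ l] exI[of _ "z - \<rho>"]) force
  qed
qed

section \<open>Sequences of solutions\<close>

text \<open>The velocity \<open>v\<close> itself need not be differentiable where it vanishes, only the flux \<open>\<phi>(v)\<close> is;
  therefore the kinetic term is differentiated as a function of the flux.\<close>

lemma kinetic_phi:
  assumes "1 < p" shows "kinetic p s = \<bar>phi p s\<bar> powr conj_exponent p / conj_exponent p"
  using assms by (simp add: kinetic_def abs_phi powr_powr conj_exponent_def)

locale bvp_sequence =
  fixes p :: real and a W :: "real \<Rightarrow> real" and \<epsilon> :: "nat \<Rightarrow> real" and u :: "nat \<Rightarrow> real \<Rightarrow> real"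
  assumes p: "1 < p"
    and a: "C1_on {0..1} a" and a_pos: "\<And>x. x \<in> {0..1} \<Longrightarrow> 0 < a x"
    and W: "C1_on {-1..1} W" "W1 p W" "W2 p W"
    and \<epsilon>_pos: "\<And>n. 0 < \<epsilon> n" and \<epsilon>_lim: "\<epsilon> \<longlonglongrightarrow> 0"
    and sol: "\<And>n. is_solution p a W (\<epsilon> n) (u n)"
begin

abbreviation D :: "real \<Rightarrow> real" where "D \<equiv> deriv_within {-1..1} W"
abbreviation da :: "real \<Rightarrow> real" where "da \<equiv> deriv_within {0..1} a"
abbreviation v :: "nat \<Rightarrow> real \<Rightarrow> real" where "v n x \<equiv> \<epsilon> n * deriv_within {0..1} (u n) x"
abbreviation en :: "nat \<Rightarrow> real \<Rightarrow> real" where "en n \<equiv> energy p a W (\<epsilon> n) (u n)"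
abbreviation q :: real where "q \<equiv> conj_exponent p"

lemma q: "1 < q"
  using p by (simp add: conj_exponent_def)

lemma u_range: "x \<in> {0..1} \<Longrightarrow> u n x \<in> {-1..1}"
  using sol[of n] unfolding is_solution_def by blast

lemma u_deriv:
  assumes "x \<in> {0..1}"
  shows "(u n has_real_derivative v n x / \<epsilon> n) (at x within {0..1})"
  using C1_on_has_real_derivative[OF _ assms, of "u n"] sol[of n] \<epsilon>_pos[of n]
  by (simp add: is_solution_def)

lemma flux_deriv:
  assumes x: "x \<in> {0..1}"
  shows "((\<lambda>x. phi p (v n x)) has_real_derivative a x * D (u n x) / \<epsilon> n) (at x within {0..1})"
proof -
  let ?du = "deriv_within {0..1} (u n)"
  have "C1_on {0..1} (\<lambda>x. phi p (?du x))" using sol[of n] by (simp add: is_solution_def)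
  from DERIV_cmult[OF C1_on_has_real_derivative[OF this x], of "\<epsilon> n powr (p - 1)"]
  have "\<exists>d. ((\<lambda>x. phi p (v n x)) has_vector_derivative d) (at x within {0..1})"
    unfolding phi_scale[OF \<epsilon>_pos] has_real_derivative_iff_has_vector_derivative by blast
  then have "((\<lambda>x. phi p (v n x)) has_real_derivative deriv_within {0..1} (\<lambda>x. phi p (v n x)) x)
      (at x within {0..1})"
    unfolding has_real_derivative_iff_has_vector_derivative deriv_within_def
    using vector_derivative_works differentiableI_vector by blast
  moreover have "deriv_within {0..1} (\<lambda>x. phi p (v n x)) x = a x * D (u n x) / \<epsilon> n"
    using sol[of n] x \<epsilon>_pos[of n] by (simp add: is_solution_def field_simps)
  ultimately show ?thesis by simp
qed

lemma energy_deriv: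
  assumes x: "x \<in> {0..1}"
  shows "(en n has_real_derivative da x / (a x)\<^sup>2 * kinetic p (v n x)) (at x within {0..1})"
proof -
  have kin: "((\<lambda>x. kinetic p (v n x)) has_real_derivative v n x * (a x * D (u n x) / \<epsilon> n))
      (at x within {0..1})"
    using DERIV_chain2[where f = "\<lambda>s. \<bar>s\<bar> powr q / q", OF has_real_derivative_abs_powr[OF q] flux_deriv[OF x]]
    unfolding kinetic_phi[OF p] phi_conj_inverse[OF p] .
  have "(W has_real_derivative D (u n x)) (at (u n x) within u n ` {0..1})"
    by (rule has_field_derivative_subset[OF C1_on_has_real_derivative[OF W(1) u_range[OF x]]])
      (use u_range in blast)
  from DERIV_image_chain[OF this u_deriv[OF x]]
  have Wu: "((\<lambda>x. W (u n x)) has_real_derivative D (u n x) * (v n x / \<epsilon> n)) (at x within {0..1})"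
    by (simp add: o_def)
  have "((\<lambda>x. W (u n x) - kinetic p (v n x) / a x) has_real_derivative
      D (u n x) * (v n x / \<epsilon> n) - (v n x * (a x * D (u n x) / \<epsilon> n) * a x - kinetic p (v n x) * da x) / (a x * a x))
      (at x within {0..1})"
    using a_pos[OF x]
    by (intro DERIV_diff DERIV_divide Wu kin C1_on_has_real_derivative[OF a x]) auto
  moreover have "D (u n x) * (v n x / \<epsilon> n) - (v n x * (a x * D (u n x) / \<epsilon> n) * a x - kinetic p (v n x) * da x) / (a x * a x)
      = da x / (a x)\<^sup>2 * kinetic p (v n x)"
    using a_pos[OF x] by (simp add: field_simps power2_eq_square)
  moreover have "(\<lambda>x. W (u n x) - kinetic p (v n x) / a x) = en n"
    by (auto simp: energy_def)
  ultimately show ?thesis by simp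
qed

lemma speed_eq:
  assumes "x \<in> {0..1}"
  shows "\<bar>v n x\<bar> powr p = q * (a x * (W (u n x) - en n x))"
  using a_pos[OF assms] q by (simp add: energy_def kinetic_def)

lemma u_continuous: "continuous_on {0..1} (u n)"
  by (rule DERIV_continuous_on[OF u_deriv])

lemma energy_continuous: "continuous_on {0..1} (en n)"
  by (rule DERIV_continuous_on[OF energy_deriv])

lemma a_bounds: "\<exists>am aM. 0 < am \<and> (\<forall>x\<in>{0..1}. am \<le> a x \<and> a x \<le> aM)"
proof -
  have cont: "continuous_on {0..1} a"
    by (rule DERIV_continuous_on[OF C1_on_has_real_derivative[OF a]])
  obtain x where x: "x \<in> {0..1}" "\<forall>z\<in>{0..1}. a x \<le> a z"
    using continuous_attains_inf[OF compact_Icc _ cont] by auto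
  obtain y where y: "\<forall>z\<in>{0..1}. a z \<le> a y"
    using continuous_attains_sup[OF compact_Icc _ cont] by auto
  show ?thesis using a_pos[OF x(1)] x(2) y by blast
qed

lemma W_continuous: "continuous_on {-1..1} W"
  by (rule DERIV_continuous_on[OF C1_on_has_real_derivative[OF W(1)]])

lemma W_nonneg: "y \<in> {-1..1} \<Longrightarrow> 0 \<le> W y"
  using well_growth[OF p W] by (meson less_imp_le mult_nonneg_nonneg order_trans powr_ge_zero)

text \<open>The factor \<open>1 - |y|\<close> in \<open>well_pull\<close> can be dropped away from the wells, where the product
  \<open>- y W'(y)\<close> is nonnegative.\<close>

lemma well_force:
  assumes y: "y \<in> {-1..1}" "0 < W y"
  shows "\<bar>y\<bar> < 1" "\<bar>y\<bar> powr p * W y \<le> - D y * y"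
proof -
  have *: "\<bar>y\<bar> powr p * W y \<le> - D y * y * (1 - \<bar>y\<bar>)"
    by (rule well_pull[OF p W y(1)])
  show y1: "\<bar>y\<bar> < 1"
  proof (rule ccontr)
    assume "\<not> \<bar>y\<bar> < 1"
    then have "\<bar>y\<bar> = 1" using y by auto
    then show False using * y by simp
  qed
  have "0 \<le> \<bar>y\<bar> powr p * W y" using y by simp
  with * have "0 \<le> - D y * y * (1 - \<bar>y\<bar>)" by linarith
  then have "0 \<le> - D y * y" using y1 by (simp only: zero_le_mult_iff) auto
  then have "- D y * y * (1 - \<bar>y\<bar>) \<le> - D y * y" by (intro mult_left_le) auto
  with * show "\<bar>y\<bar> powr p * W y \<le> - D y * y" by linarith
qed

lemma near_maximum: "\<exists>r>0. \<forall>y\<in>{-1..1}. \<bar>y\<bar> \<le> r \<longrightarrow> W 0 / 2 \<le> W y"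
proof -
  have W0: "0 < W 0" by (rule well_max_pos[OF p W])
  obtain d where d: "0 < d" "\<And>y. y \<in> {-1..1} \<Longrightarrow> \<bar>y\<bar> < d \<Longrightarrow> \<bar>W y - W 0\<bar> < W 0 / 2"
    using W_continuous[unfolded continuous_on_iff, rule_format, of 0 "W 0 / 2"] W0
    by (auto simp: dist_real_def)
  have "W 0 / 2 \<le> W y" if "y \<in> {-1..1}" "\<bar>y\<bar> \<le> d / 2" for y
    using d(2)[of y] that d(1) by linarith
  with d(1) show ?thesis by (intro exI[of _ "d / 2"]) auto
qed

lemma scaled_vanishes:
  assumes "0 < r" "0 < (\<delta>::real)"
  shows "eventually (\<lambda>n. K * \<epsilon> n powr r < \<delta>) sequentially"
proof -
  have "(\<lambda>n. K * \<epsilon> n powr r) \<longlonglongrightarrow> K * 0 powr r"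
    using assms \<epsilon>_pos by (intro tendsto_intros tendsto_powr2 \<epsilon>_lim) (auto simp: less_imp_le)
  then show ?thesis using assms by (auto dest: order_tendstoD(2))
qed

text \<open>As \<open>W \<ge> 0\<close>, energy at most \<open>- h\<close> forces \<open>|v|\<^sup>p\<close> to be of order at least \<open>h\<close>.\<close>

lemma negative_energy_estimate:
  assumes am: "0 < am" "\<And>x. x \<in> {0..1} \<Longrightarrow> am \<le> a x"
    and st: "s < t" "{s..t} \<subseteq> {0..1}" and h: "0 < h" "\<And>x. x \<in> {s..t} \<Longrightarrow> en n x \<le> - h"
  shows "(q * am * h) powr (1 / p) * (t - s) \<le> 2 * \<epsilon> n"
proof (rule fast_motion[OF st \<epsilon>_pos])
  fix x assume x: "x \<in> {s..t}"
  then have x01: "x \<in> {0..1}" using st by blast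
  show "(u n has_real_derivative v n x / \<epsilon> n) (at x within {0..1})" using u_deriv[OF x01] .
  show "\<bar>u n x\<bar> \<le> 1" using u_range[OF x01, of n] by auto
  have "q * (am * h) \<le> \<bar>v n x\<bar> powr p"
    unfolding speed_eq[OF x01] using q am h(1) h(2)[OF x] W_nonneg[OF u_range[OF x01, of n]] am(2)[OF x01]
    by (intro mult_left_mono mult_mono) auto
  then have "(q * am * h) powr (1 / p) \<le> (\<bar>v n x\<bar> powr p) powr (1 / p)"
    using q am h p by (intro powr_mono2) (auto simp: mult.assoc)
  then show "(q * am * h) powr (1 / p) \<le> \<bar>v n x\<bar>" using p by (simp add: powr_powr)
qed

text \<open>As \<open>W(u) \<ge> E \<ge> h\<close>, the force satisfies \<open>- u W'(u) \<ge> h |u|\<^sup>p\<close>; after a change of sign the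
  solution is positive and the comparison argument applies.\<close>

lemma positive_energy_estimate:
  assumes am: "0 < am" "\<And>x. x \<in> {0..1} \<Longrightarrow> am \<le> a x"
    and st: "s < t" "{s..t} \<subseteq> {0..1}" and h: "0 < h" "\<And>x. x \<in> {s..t} \<Longrightarrow> h \<le> en n x"
    and nz: "\<And>x. x \<in> {s..t} \<Longrightarrow> u n x \<noteq> 0"
  shows "am * h * ((t - s) / 3) powr p \<le> 2 * 3 powr (p - 1) * \<epsilon> n powr p"
proof -
  have sgn: "\<sigma> * u n x > 0" if "x \<in> {s..t}" and "\<sigma> = sgn (u n s)" for x \<sigma>
  proof (rule ccontr)
    assume neg: "\<not> \<sigma> * u n x > 0"
    have cont: "continuous_on {s..x} (\<lambda>x. \<sigma> * u n x)"
      using that st by (intro continuous_intros continuous_on_subset[OF u_continuous]) auto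
    have "0 \<le> \<sigma> * u n s" using that by (simp add: sgn_if)
    with IVT2'[OF _ _ _ cont, of 0] neg that obtain y where "s \<le> y" "y \<le> x" "\<sigma> * u n y = 0" by auto
    moreover have "\<sigma> \<noteq> 0" using nz[of s] st that by (simp add: sgn_zero_iff)
    ultimately show False using nz[of y] that by auto
  qed
  define \<sigma> where "\<sigma> = sgn (u n s)"
  have \<sigma>: "\<sigma> = 1 \<or> \<sigma> = - 1" using nz[of s] st by (auto simp: \<sigma>_def sgn_if)
  show ?thesis
  proof (rule positive_solution_short[OF p st \<epsilon>_pos, where u = "\<lambda>x. \<sigma> * u n x" and v = "\<lambda>x. \<sigma> * v n x"
        and f = "\<lambda>x. \<sigma> * (a x * D (u n x))"])
    show "0 < am * h" using am h by simp
    fix x assume x: "x \<in> {s..t}"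
    then have x01: "x \<in> {0..1}" using st by blast
    show "((\<lambda>x. \<sigma> * u n x) has_real_derivative \<sigma> * v n x / \<epsilon> n) (at x within {0..1})"
      using DERIV_cmult[OF u_deriv[OF x01], of \<sigma>] by (simp only: times_divide_eq_right mult.assoc)
    have "phi p (\<sigma> * y) = \<sigma> * phi p y" for y using \<sigma> by (auto simp: phi_minus)
    then show "((\<lambda>x. phi p (\<sigma> * v n x)) has_real_derivative \<sigma> * (a x * D (u n x)) / \<epsilon> n) (at x within {0..1})"
      using DERIV_cmult[OF flux_deriv[OF x01], of \<sigma>] by simp
    show pos: "0 < \<sigma> * u n x" using sgn[OF x] \<sigma>_def by simp
    then have abs: "\<bar>u n x\<bar> = \<sigma> * u n x" using \<sigma> by auto
    have "0 \<le> \<bar>v n x\<bar> powr p" by simp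
    then have "0 \<le> W (u n x) - en n x"
      unfolding speed_eq[OF x01] using q a_pos[OF x01] by (simp add: zero_le_mult_iff)
    then have Wh: "h \<le> W (u n x)" using h(2)[OF x] by linarith
    have "\<bar>u n x\<bar> powr p * h \<le> \<bar>u n x\<bar> powr p * W (u n x)" using Wh by (intro mult_left_mono) auto
    also have "\<dots> \<le> - D (u n x) * u n x"
      using well_force(2)[OF u_range[OF x01]] Wh h(1) by fastforce
    also have "\<dots> = - (\<sigma> * D (u n x)) * (\<sigma> * u n x)" using \<sigma> by auto
    finally have "(\<sigma> * u n x) * ((\<sigma> * u n x) powr (p - 1) * h) \<le> (\<sigma> * u n x) * - (\<sigma> * D (u n x))"
      using powr_add[of "\<sigma> * u n x" 1 "p - 1"] pos unfolding abs by (simp add: mult_ac)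
    then have 1: "(\<sigma> * u n x) powr (p - 1) * h \<le> - (\<sigma> * D (u n x))"
      using pos by (simp only: mult_le_cancel_left_pos)
    have "am * ((\<sigma> * u n x) powr (p - 1) * h) \<le> a x * ((\<sigma> * u n x) powr (p - 1) * h)"
      using am(2)[OF x01] h by (intro mult_right_mono) auto
    also have "\<dots> \<le> a x * - (\<sigma> * D (u n x))" using 1 a_pos[OF x01] by (intro mult_left_mono) auto
    finally show "\<sigma> * (a x * D (u n x)) \<le> - (am * h) * (\<sigma> * u n x) powr (p - 1)"
      by (simp add: mult_ac)
  qed
qed

text \<open>Near the maximum of \<open>W\<close> the kinetic energy is bounded below. Elsewhere the force does the work:
  \<open>- u W'(u) \<ge> |u|\<^sup>p W(u) / (1 - |u|)\<close>, and \<open>1 - |u| \<le> (W(u) / k)\<^bsup>1/p\<^esup>\<close>, so the force is at least of order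
  \<open>W(u)\<^bsup>1 - 1/p\<^esup> \<ge> E\<^bsup>1 - 1/p\<^esup>\<close>. That this exponent is less than \<open>1\<close> is what makes the multiplier
  \<open>E\<^bsup>- \<theta>\<^esup>\<close> with \<open>\<theta> = 1 - 1/p\<close> integrate to a positive power of \<open>E\<close>.\<close>

lemma coercivity:
  "\<exists>c h0. 0 < c \<and> 0 < h0 \<and> (\<forall>n. \<forall>x\<in>{0..1}. 0 < en n x \<longrightarrow> en n x \<le> h0 \<longrightarrow>
    c * en n x powr (1 - 1 / p) \<le> \<bar>v n x\<bar> powr p - a x * D (u n x) * u n x)"
proof -
  obtain am where am: "0 < am" "\<And>x. x \<in> {0..1} \<Longrightarrow> am \<le> a x"
    using a_bounds by blast
  obtain r where r: "0 < r" "\<And>y. y \<in> {-1..1} \<Longrightarrow> \<bar>y\<bar> \<le> r \<Longrightarrow> W 0 / 2 \<le> W y"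
    using near_maximum by blast
  obtain k where k: "0 < k" "\<And>y. y \<in> {-1..1} \<Longrightarrow> k * (1 - \<bar>y\<bar>) powr p \<le> W y"
    using well_growth[OF p W] by blast
  note W0 = well_max_pos[OF p W]
  define c1 c2 where "c1 = q * (am * (W 0 / 4))" and "c2 = am * (r powr p * k powr (1 / p))"
  have c: "0 < c1" "0 < c2" using q am r k W0 by (auto simp: c1_def c2_def)
  have "min c1 c2 * en n x powr (1 - 1 / p) \<le> \<bar>v n x\<bar> powr p - a x * D (u n x) * u n x"
    if x: "x \<in> {0..1}" and en: "0 < en n x" "en n x \<le> min 1 (W 0 / 4)" for n x
  proof -
    define y \<theta> where "y = u n x" and "\<theta> = 1 - 1 / p"
    have \<theta>: "0 < \<theta>" using p by (simp add: \<theta>_def)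
    have y: "y \<in> {-1..1}" using u_range[OF x] by (simp add: y_def)
    have "0 \<le> \<bar>v n x\<bar> powr p" by simp
    then have "0 \<le> W y - en n x"
      unfolding speed_eq[OF x] y_def using q a_pos[OF x] by (simp add: zero_le_mult_iff)
    then have Wy: "en n x \<le> W y" "0 < W y" using en by auto
    note force = well_force[OF y Wy(2)]
    have "0 \<le> \<bar>y\<bar> powr p * W y" using Wy(2) by simp
    with force(2) have Dy: "0 \<le> - D y * y" by linarith
    have "min c1 c2 * en n x powr \<theta> \<le> \<bar>v n x\<bar> powr p + a x * (- D y * y)"
    proof (cases "\<bar>y\<bar> \<le> r")
      case True
      have "en n x powr \<theta> \<le> 1" using en \<theta> by (intro powr_le1) auto
      then have "min c1 c2 * en n x powr \<theta> \<le> min c1 c2" using c by (intro mult_left_le) auto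
      also have "\<dots> \<le> c1" by simp
      also have "c1 \<le> \<bar>v n x\<bar> powr p"
        unfolding speed_eq[OF x] c1_def using q am r en am(2)[OF x] W0 r(2)[OF y True]
        by (intro mult_left_mono mult_mono) (auto simp: y_def)
      also have "\<dots> \<le> \<bar>v n x\<bar> powr p + a x * (- D y * y)"
        using a_pos[OF x] Dy mult_nonneg_nonneg[of "a x" "- D y * y"] by simp
      finally show ?thesis .
    next
      case False
      have gap: "1 - \<bar>y\<bar> \<le> (W y / k) powr (1 / p)"
      proof -
        have "(1 - \<bar>y\<bar>) powr p \<le> W y / k" using k(1) k(2)[OF y] by (simp add: field_simps)
        then have "((1 - \<bar>y\<bar>) powr p) powr (1 / p) \<le> (W y / k) powr (1 / p)"
          using p by (intro powr_mono2) auto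
        then show ?thesis using p force(1) by (simp add: powr_powr)
      qed
      have "r powr p * W y \<le> \<bar>y\<bar> powr p * W y"
        using False r p Wy by (intro mult_right_mono powr_mono2) auto
      also have "\<dots> \<le> - D y * y * (1 - \<bar>y\<bar>)" using well_pull[OF p W y] .
      also have "\<dots> \<le> - D y * y * (W y / k) powr (1 / p)" using gap Dy by (intro mult_left_mono) auto
      finally have *: "r powr p * W y \<le> - D y * y * (W y powr (1 / p) / k powr (1 / p))"
        using Wy k by (simp add: powr_divide)
      have Wsplit: "W y = W y powr (1 / p) * W y powr \<theta>"
        using Wy by (simp add: \<theta>_def flip: powr_add)
      have "W y powr (1 / p) * (r powr p * k powr (1 / p) * W y powr \<theta>)
          = (r powr p * (W y powr (1 / p) * W y powr \<theta>)) * k powr (1 / p)"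
        by (simp only: mult_ac)
      also have "\<dots> = (r powr p * W y) * k powr (1 / p)" by (simp only: Wsplit[symmetric])
      also have "\<dots> \<le> (- D y * y * (W y powr (1 / p) / k powr (1 / p))) * k powr (1 / p)"
        using * by (intro mult_right_mono) auto
      also have "\<dots> = W y powr (1 / p) * (- D y * y)" using k by simp
      finally have "r powr p * k powr (1 / p) * W y powr \<theta> \<le> - D y * y"
        using Wy by (simp only: mult_le_cancel_left_pos powr_gt_zero)
      moreover have "r powr p * k powr (1 / p) * en n x powr \<theta> \<le> r powr p * k powr (1 / p) * W y powr \<theta>"
        using Wy en \<theta> by (intro mult_left_mono powr_mono2) auto
      ultimately have **: "r powr p * k powr (1 / p) * en n x powr \<theta> \<le> - D y * y" by linarith
      have "min c1 c2 * en n x powr \<theta> \<le> c2 * en n x powr \<theta>" by (intro mult_right_mono) auto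
      also have "\<dots> = am * (r powr p * k powr (1 / p) * en n x powr \<theta>)" by (simp add: c2_def)
      also have "\<dots> \<le> a x * (- D y * y)" by (rule mult_mono) (use ** am(1) am(2)[OF x] in auto)
      also have "\<dots> \<le> \<bar>v n x\<bar> powr p + a x * (- D y * y)" by simp
      finally show ?thesis .
    qed
    then show ?thesis by (simp add: y_def \<theta>_def mult.assoc)
  qed
  moreover have "0 < min c1 c2" "0 < min 1 (W 0 / 4)" using c W0 by auto
  ultimately show ?thesis by blast
qed

text \<open>Where \<open>a'\<close> has the sign \<open>\<sigma>\<close>, the function \<open>\<sigma> E\<^sub>n\<close> increases, and a zero makes it jump by \<open>k \<epsilon>\<close>
  across a layer of width \<open>R \<epsilon>\<close> on either side. The dichotomy then gives an interval of length \<open>\<delta>\<close> on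
  which either \<open>u\<^sub>n\<close> moves too fast to stay in \<open>[-1, 1]\<close>, or the multiplier estimate makes the
  energy larger than its bound \<open>h\<close>. All constants are chosen before \<open>n\<close>.\<close>

lemma no_zeros_where_weight_monotone:
  assumes lr: "{l..r} \<subseteq> {0..1}" and \<delta>: "0 < \<delta>" and \<sigma>: "\<bar>\<sigma>\<bar> = 1" and m0: "0 < m0"
    and da: "\<And>x. x \<in> {l..r} \<Longrightarrow> m0 \<le> \<sigma> * da x"
    and small: "\<And>h. 0 < h \<Longrightarrow> eventually (\<lambda>n. \<forall>x\<in>{l..r}. \<bar>en n x\<bar> < h) sequentially"
  shows "eventually (\<lambda>n. \<forall>z\<in>{l + 2 * \<delta>..r - 2 * \<delta>}. u n z \<noteq> 0) sequentially"
proof -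
  obtain am aM where a_bnd: "0 < am" "\<And>x. x \<in> {0..1} \<Longrightarrow> am \<le> a x" "\<And>x. x \<in> {0..1} \<Longrightarrow> a x \<le> aM"
    using a_bounds by blast
  have aM: "0 < aM" using a_bnd(1) a_bnd(2,3)[of 0] by simp
  obtain y where y: "y \<in> {-1..1}" "\<And>x. x \<in> {-1..1} \<Longrightarrow> W x \<le> W y"
    using continuous_attains_sup[OF compact_Icc _ W_continuous] by auto
  note W0 = well_max_pos[OF p W]
  obtain r0 where r0: "0 < r0" "\<And>y. y \<in> {-1..1} \<Longrightarrow> \<bar>y\<bar> \<le> r0 \<Longrightarrow> W 0 / 2 \<le> W y"
    using near_maximum by blast
  obtain c h0 where c: "0 < c" "0 < h0"
    "\<And>n x. x \<in> {0..1} \<Longrightarrow> 0 < en n x \<Longrightarrow> en n x \<le> h0 \<Longrightarrow>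
      c * en n x powr (1 - 1 / p) \<le> \<bar>v n x\<bar> powr p - a x * D (u n x) * u n x"
    using coercivity by blast
  \<comment> \<open>Bound for the speed once \<open>|E\<^sub>n| \<le> 1\<close>.\<close>
  define V where "V = (q * (aM * (W y + 1))) powr (1 / p)"
  have "0 < W y" using W0 y(2)[of 0] by simp
  then have V: "0 < V" using q aM by (simp add: V_def)
  define B where "B = V powr (p - 1)"
  have B: "0 < B" using V by (simp add: B_def)
  define m where "m = m0 / aM\<^sup>2 / q"
  have m: "0 < m" using m0 aM q by (simp add: m_def)
  \<comment> \<open>At speed \<open>V\<close> it takes at least \<open>R \<epsilon>\<close> to get from a zero to the level \<open>r0\<close>, and until then \<open>\<sigma> E\<^sub>n\<close>
    grows at rate at least \<open>k0\<close>.\<close>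
  define R where "R = r0 / V"
  define k0 where "k0 = m * (q * (am * (W 0 / 4)))"
  define k where "k = k0 * R"
  have k: "0 < R" "0 < k0" "0 < k" using r0 W0 V m q a_bnd(1) by (auto simp: R_def k0_def k_def)
  define K1 K2 where "K1 = (2 / m + (1 - 1 / p) * B / k) / (1 - (1 - 1 / p))"
    and "K2 = 2 * B * k powr (- (1 - 1 / p))"
  have K1: "0 < K1" using m B k p unfolding K1_def
    by (intro divide_pos_pos add_pos_nonneg) auto
  \<comment> \<open>Small enough that the energy term in the multiplier estimate takes up only a quarter of \<open>c \<delta>\<close>.\<close>
  define h where "h = Min {h0, 1, W 0 / 4, (c * \<delta> / (4 * K1)) powr p}"
  have h: "0 < h" "h \<le> h0" "h \<le> 1" "h \<le> W 0 / 4" "h \<le> (c * \<delta> / (4 * K1)) powr p"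
    using c W0 \<delta> K1 by (auto simp: h_def)
  have "K1 * h powr (1 / p) \<le> K1 * ((c * \<delta> / (4 * K1)) powr p) powr (1 / p)"
    using h K1 p by (intro mult_left_mono powr_mono2) auto
  then have K1h: "K1 * h powr (1 / p) \<le> c * \<delta> / 4" using K1 p c \<delta> by (simp add: powr_powr)
  have e1: "eventually (\<lambda>n. R * \<epsilon> n powr 1 < \<delta>) sequentially"
    using \<delta> by (intro scaled_vanishes) auto
  have e2: "eventually (\<lambda>n. K2 * \<epsilon> n powr (1 / p) < c * \<delta> / 4) sequentially"
    using \<delta> c p by (intro scaled_vanishes) auto
  have e3: "eventually (\<lambda>n. 2 * \<epsilon> n powr (1 - 1 / p) < (q * am * k) powr (1 / p) * \<delta>) sequentially"
    using \<delta> p q a_bnd(1) k by (intro scaled_vanishes) auto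
  from small[OF h(1)] e1 e2 e3 show ?thesis
  proof eventually_elim
    case (elim n)
    have \<epsilon>: "0 < \<epsilon> n" "R * \<epsilon> n < \<delta>" using \<epsilon>_pos[of n] elim(2) by auto
    have en: "\<bar>en n x\<bar> < h" if "x \<in> {l..r}" for x using elim(1) that by blast
    have speed: "\<bar>v n x\<bar> \<le> V" if x: "x \<in> {l..r}" for x
    proof -
      have x01: "x \<in> {0..1}" using lr x by blast
      have "\<bar>v n x\<bar> powr p \<le> q * (a x * (W y + 1))" unfolding speed_eq[OF x01]
        using q a_pos[OF x01] en[OF x] h y(2)[OF u_range[OF x01, of n]]
        by (intro mult_left_mono) (auto simp: abs_less_iff)
      also have "\<dots> \<le> q * (aM * (W y + 1))"
        using q a_bnd(3)[OF x01] \<open>0 < W y\<close> by (intro mult_left_mono mult_right_mono) auto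
      finally have "(\<bar>v n x\<bar> powr p) powr (1 / p) \<le> V" unfolding V_def using p by (intro powr_mono2) auto
      then show ?thesis using p by (simp add: powr_powr)
    qed
    have grow: "m * \<bar>v n x\<bar> powr p \<le> \<sigma> * (da x / (a x)\<^sup>2 * kinetic p (v n x))" if x: "x \<in> {l..r}" for x
    proof -
      have x01: "x \<in> {0..1}" using lr x by blast
      have "m0 / aM\<^sup>2 \<le> \<sigma> * da x / (a x)\<^sup>2"
        using da[OF x] m0 a_pos[OF x01] a_bnd(3)[OF x01] by (intro frac_le power_mono) auto
      then have "m0 / aM\<^sup>2 * kinetic p (v n x) \<le> \<sigma> * da x / (a x)\<^sup>2 * kinetic p (v n x)"
        using q by (intro mult_right_mono) (auto simp: kinetic_def)
      then show ?thesis by (simp add: m_def kinetic_def)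
    qed
    have der: "((\<lambda>x. \<sigma> * en n x) has_real_derivative \<sigma> * (da x / (a x)\<^sup>2 * kinetic p (v n x)))
        (at x within {0..1})" if "x \<in> {l..r}" for x
      using that lr by (intro DERIV_cmult energy_deriv) auto
    have mono: "\<sigma> * en n x \<le> \<sigma> * en n y" if xy: "l \<le> x" "x \<le> y" "y \<le> r" for x y
    proof (cases "x = y")
      case False
      obtain \<xi> where \<xi>: "x < \<xi>" "\<xi> < y" "\<sigma> * en n y - \<sigma> * en n x = \<sigma> * (da \<xi> / (a \<xi>)\<^sup>2 * kinetic p (v n \<xi>)) * (y - x)"
        by (rule mvt_within[OF _ _ der, of x y]) (use xy False lr in auto)
      have "0 \<le> m * \<bar>v n \<xi>\<bar> powr p" using m by simp
      also have "\<dots> \<le> \<sigma> * (da \<xi> / (a \<xi>)\<^sup>2 * kinetic p (v n \<xi>))" using grow[of \<xi>] \<xi> xy by simp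
      finally have "0 \<le> \<sigma> * (da \<xi> / (a \<xi>)\<^sup>2 * kinetic p (v n \<xi>)) * (y - x)"
        by (rule mult_nonneg_nonneg) (use xy in simp)
      then show ?thesis using \<xi>(3) by linarith
    qed simp
    show ?case
    proof (intro ballI notI)
      fix z assume z: "z \<in> {l + 2 * \<delta>..r - 2 * \<delta>}" and uz: "u n z = 0"
      define \<rho> where "\<rho> = R * \<epsilon> n"
      have \<rho>: "0 < \<rho>" "\<rho> \<le> \<delta>" using k \<epsilon> by (auto simp: \<rho>_def)
      have layer: "k0 \<le> \<sigma> * (da x / (a x)\<^sup>2 * kinetic p (v n x))" if x: "\<bar>x - z\<bar> \<le> \<rho>" for x
      proof -
        have xlr: "x \<in> {l..r}" using x z \<rho> \<delta> by (auto simp: abs_le_iff)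
        have x01: "x \<in> {0..1}" using lr xlr by blast
        have zlr: "z \<in> {l..r}" using z \<delta> by auto
        have "\<bar>u n x - u n z\<bar> \<le> V / \<epsilon> n * \<bar>x - z\<bar>"
        proof -
          have "norm (u n x - u n z) \<le> V / \<epsilon> n * norm (x - z)"
          proof (rule field_differentiable_bound[of "{l..r}" "u n" "\<lambda>x. v n x / \<epsilon> n"])
            fix y assume y: "y \<in> {l..r}"
            show "(u n has_real_derivative v n y / \<epsilon> n) (at y within {l..r})"
              using y lr by (intro has_field_derivative_subset[OF u_deriv lr]) auto
            have "\<bar>v n y\<bar> / \<epsilon> n \<le> V / \<epsilon> n" using speed[OF y] \<epsilon> by (intro divide_right_mono) auto
            then show "norm (v n y / \<epsilon> n) \<le> V / \<epsilon> n" using \<epsilon> by (simp add: abs_mult)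
          qed (use xlr zlr in auto)
          then show ?thesis by simp
        qed
        also have "\<dots> \<le> V / \<epsilon> n * \<rho>" using x V \<epsilon> by (intro mult_left_mono) auto
        also have "\<dots> = r0" using V \<epsilon> by (simp add: \<rho>_def R_def)
        finally have "\<bar>u n x\<bar> \<le> r0" using uz by simp
        from r0(2)[OF u_range[OF x01] this] en[OF xlr] h
        have "W 0 / 4 \<le> W (u n x) - en n x" by (auto simp: abs_less_iff)
        then have "q * (am * (W 0 / 4)) \<le> \<bar>v n x\<bar> powr p" unfolding speed_eq[OF x01]
          using q a_bnd(1) a_bnd(2)[OF x01] W0 by (intro mult_left_mono mult_mono) auto
        then have "k0 \<le> m * \<bar>v n x\<bar> powr p" unfolding k0_def using m by (intro mult_left_mono) auto
        then show ?thesis using grow[OF xlr] by linarith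
      qed
      have jump: "k * \<epsilon> n \<le> \<sigma> * (en n y - en n x)" if xy: "y - x = \<rho>" "z - \<rho> \<le> x" "y \<le> z + \<rho>" for x y
      proof -
        obtain \<xi> where \<xi>: "x < \<xi>" "\<xi> < y" "\<sigma> * en n y - \<sigma> * en n x = \<sigma> * (da \<xi> / (a \<xi>)\<^sup>2 * kinetic p (v n \<xi>)) * (y - x)"
          by (rule mvt_within[OF _ _ der, of x y]) (use xy \<rho> z \<delta> lr in auto)
        have "k0 * (y - x) \<le> \<sigma> * (da \<xi> / (a \<xi>)\<^sup>2 * kinetic p (v n \<xi>)) * (y - x)"
          using layer[of \<xi>] \<xi> xy \<rho> by (intro mult_right_mono) auto
        then show ?thesis using \<xi>(3) xy by (simp add: k_def \<rho>_def right_diff_distrib mult_ac)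
      qed
      have "\<exists>s t. l \<le> s \<and> t \<le> r \<and> \<delta> \<le> t - s \<and>
        ((\<forall>x\<in>{s..t}. k * \<epsilon> n \<le> en n x) \<or> (\<forall>x\<in>{s..t}. en n x \<le> - (k * \<epsilon> n)))"
        using z \<rho> by (intro layer_dichotomy[OF mono \<sigma>, where \<delta> = \<delta> and z = z and \<rho> = \<rho>] jump) auto
      then obtain s t where st: "l \<le> s" "t \<le> r" "\<delta> \<le> t - s" and
        alt: "(\<forall>x\<in>{s..t}. k * \<epsilon> n \<le> en n x) \<or> (\<forall>x\<in>{s..t}. en n x \<le> - (k * \<epsilon> n))" by blast
      have sub: "s < t" "{s..t} \<subseteq> {0..1}" using st \<delta> lr by auto
      have inlr: "x \<in> {l..r}" "x \<in> {0..1}" if "x \<in> {s..t}" for x using that st sub by auto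
      from alt show False
      proof
        assume low: "\<forall>x\<in>{s..t}. en n x \<le> - (k * \<epsilon> n)"
        have "(q * am * (k * \<epsilon> n)) powr (1 / p) * (t - s) \<le> 2 * \<epsilon> n"
          using low k \<epsilon> by (intro negative_energy_estimate[OF a_bnd(1,2) sub]) auto
        moreover have "(q * am * (k * \<epsilon> n)) powr (1 / p) = (q * am * k) powr (1 / p) * \<epsilon> n powr (1 / p)"
          using q a_bnd(1) k \<epsilon> by (simp add: powr_mult mult_ac)
        moreover have "\<dots> * \<delta> \<le> \<dots> * (t - s)" using st by (intro mult_left_mono) auto
        ultimately have "((q * am * k) powr (1 / p) * \<delta>) * \<epsilon> n powr (1 / p) \<le> 2 * \<epsilon> n"
          by (simp add: mult_ac)
        also have "2 * \<epsilon> n = (2 * \<epsilon> n powr (1 - 1 / p)) * \<epsilon> n powr (1 / p)"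
          using \<epsilon> by (simp add: mult.assoc flip: powr_add)
        finally have "(q * am * k) powr (1 / p) * \<delta> \<le> 2 * \<epsilon> n powr (1 - 1 / p)"
          by (rule mult_right_le_imp_le) (use \<epsilon> in simp)
        with elim(4) show False by linarith
      next
        assume high: "\<forall>x\<in>{s..t}. k * \<epsilon> n \<le> en n x"
        have ke: "0 < k * \<epsilon> n" using k \<epsilon> by simp
        have "c * (t - s) \<le> (2 / m + (1 - 1 / p) * B / k) / (1 - (1 - 1 / p)) * h powr (1 - (1 - 1 / p))
            + 2 * B * k powr (- (1 - 1 / p)) * \<epsilon> n powr (1 - (1 - 1 / p))"
        proof (rule multiplier_estimate[OF sub \<epsilon>(1) _ _ m k(3) less_imp_le[OF B] \<sigma>,
            where u = "u n" and v = "v n" and E = "en n" and p = p])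
          fix x assume x: "x \<in> {s..t}"
          note x' = inlr[OF x]
          show "(u n has_real_derivative v n x / \<epsilon> n) (at x within {0..1})" by (rule u_deriv[OF x'(2)])
          show "((\<lambda>x. phi p (v n x)) has_real_derivative a x * D (u n x) / \<epsilon> n) (at x within {0..1})"
            by (rule flux_deriv[OF x'(2)])
          show "(en n has_real_derivative da x / (a x)\<^sup>2 * kinetic p (v n x)) (at x within {0..1})"
            by (rule energy_deriv[OF x'(2)])
          show "m * \<bar>v n x\<bar> powr p \<le> \<sigma> * (da x / (a x)\<^sup>2 * kinetic p (v n x))" by (rule grow[OF x'(1)])
          show "k * \<epsilon> n \<le> en n x" using high x by blast
          show "en n x \<le> h" using en[OF x'(1)] by simp
          have "\<bar>phi p (v n x)\<bar> \<le> B" unfolding abs_phi B_def using speed[OF x'(1)] p by (intro powr_mono2) auto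
          moreover have "\<bar>u n x\<bar> \<le> 1" using u_range[OF x'(2), of n] by auto
          ultimately have "\<bar>phi p (v n x)\<bar> * \<bar>u n x\<bar> \<le> B * 1" using B by (intro mult_mono) auto
          then show "\<bar>phi p (v n x) * u n x\<bar> \<le> B" by (simp add: abs_mult)
          have "0 < en n x" "en n x \<le> h0" using high x ke en[OF x'(1)] h by (force, force)
          from c(3)[OF x'(2) this]
          show "c * en n x powr (1 - 1 / p) \<le> \<bar>v n x\<bar> powr p - a x * D (u n x) * u n x" .
        qed (use p in auto)
        then have "c * (t - s) \<le> K1 * h powr (1 / p) + K2 * \<epsilon> n powr (1 / p)"
          unfolding K1_def K2_def by simp
        moreover have "c * \<delta> \<le> c * (t - s)" using st c by (intro mult_left_mono) auto
        moreover have "0 < c * \<delta>" using c \<delta> by simp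
        ultimately show False using K1h elim(3) by linarith
      qed
    qed
  qed
qed

lemma zeros_where_energy_nonzero:
  assumes st: "s < t" "{s..t} \<subseteq> {0..1}" and h: "0 < h"
    and en: "eventually (\<lambda>n. \<forall>x\<in>{s..t}. h \<le> en n x) sequentially \<or>
      eventually (\<lambda>n. \<forall>x\<in>{s..t}. en n x \<le> - h) sequentially"
  shows "eventually (\<lambda>n. \<exists>x\<in>{s..t}. u n x = 0) sequentially"
proof -
  obtain am aM where am: "0 < am" "\<And>x. x \<in> {0..1} \<Longrightarrow> am \<le> a x"
    "\<And>x. x \<in> {0..1} \<Longrightarrow> a x \<le> aM"
    using a_bounds by blast
  from en show ?thesis
  proof
    assume high: "eventually (\<lambda>n. \<forall>x\<in>{s..t}. h \<le> en n x) sequentially"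
    have "eventually (\<lambda>n. 2 * 3 powr (p - 1) * \<epsilon> n powr p < am * h * ((t - s) / 3) powr p) sequentially"
      using p am h st by (intro scaled_vanishes) auto
    with high show ?thesis
    proof eventually_elim
      case (elim n)
      then show ?case using positive_energy_estimate[OF am(1,2) st h, of n] by force
    qed
  next
    assume low: "eventually (\<lambda>n. \<forall>x\<in>{s..t}. en n x \<le> - h) sequentially"
    have "eventually (\<lambda>n. 2 * \<epsilon> n powr 1 < (q * am * h) powr (1 / p) * (t - s)) sequentially"
      using q am h st by (intro scaled_vanishes) auto
    with low show ?thesis
    proof eventually_elim
      case (elim n)
      then show ?case using negative_energy_estimate[OF am(1,2) st h, of n] \<epsilon>_pos[of n] by force
    qed
  qed
qed

end

section \<open>Zeros and the support of the limit energy\<close>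

theorem proposition4p2:
  fixes p :: real and a W E :: "real \<Rightarrow> real"
    and \<epsilon> :: "nat \<Rightarrow> real" and u :: "nat \<Rightarrow> real \<Rightarrow> real"
  assumes "p > 1"
    and "C1_on {0..1} a" and "\<And>x. x \<in> {0..1} \<Longrightarrow> a x > 0"
    and "C1_on {-1..1} W" and "W1 p W" and "W2 p W"
    and "\<And>n. \<epsilon> n > 0" and "\<epsilon> \<longlonglongrightarrow> 0"
    and "\<And>n. is_solution p a W (\<epsilon> n) (u n)"
    and "uniform_limit {0..1} (\<lambda>n. energy p a W (\<epsilon> n) (u n)) E sequentially"
  shows "supp E \<subseteq> zero_accumulations u \<and>
    zero_accumulations u \<subseteq> supp E \<union> {x \<in> {0..1}. deriv_within {0..1} a x = 0} \<union> {0, 1}"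
proof -
  interpret bvp_sequence p a W \<epsilon> u
    using assms by unfold_locales auto
  note conv = uniform_limitD[OF assms(10)]
  have contE: "continuous_on {0..1} E"
    by (rule uniform_limit_theorem[OF always_eventually[OF allI[OF energy_continuous]] assms(10)]) simp
  have "{x \<in> {0..1}. E x \<noteq> 0} \<subseteq> zero_accumulations u"
  proof
    fix x0 assume "x0 \<in> {x \<in> {0..1}. E x \<noteq> 0}"
    then have x0: "x0 \<in> {0..1}" "E x0 \<noteq> 0" by auto
    define h where "h = \<bar>E x0\<bar> / 4"
    have h: "0 < h" using x0 by (simp add: h_def)
    obtain d where d: "0 < d" "\<And>x. x \<in> {0..1} \<Longrightarrow> \<bar>x - x0\<bar> < d \<Longrightarrow> \<bar>E x - E x0\<bar> < h"
      using contE[unfolded continuous_on_iff, rule_format, OF x0(1) h] by (auto simp: dist_real_def)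
    have "x0 \<in> closure (\<Union>j\<in>{N..}. {x \<in> {0..1}. u j x = 0})" for N
      unfolding closure_approachable
    proof (intro allI impI)
      fix \<delta> :: real assume \<delta>: "0 < \<delta>"
      define r where "r = min d \<delta> / 2"
      have r: "0 < r" "r < d" "r < \<delta>" using d \<delta> by (auto simp: r_def min_def)
      \<comment> \<open>Truncated at \<open>0\<close> and \<open>1\<close>, since \<open>x0\<close> may be an endpoint.\<close>
      define s t where "s = max 0 (x0 - r)" and "t = min 1 (x0 + r)"
      have st: "s < t" "{s..t} \<subseteq> {0..1}" using x0 r by (auto simp: s_def t_def)
      have near: "\<bar>x - x0\<bar> \<le> r" if "x \<in> {s..t}" for x using that by (auto simp: s_def t_def)
      have close: "eventually (\<lambda>n. \<forall>x\<in>{s..t}. \<bar>en n x - E x0\<bar> < 2 * h) sequentially"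
        using conv[OF h]
      proof eventually_elim
        case (elim n)
        show ?case
        proof
          fix x assume x: "x \<in> {s..t}"
          then have "\<bar>en n x - E x\<bar> < h" using elim st by (auto simp: dist_real_def)
          moreover have "\<bar>E x - E x0\<bar> < h" using d(2)[of x] near[OF x] x st r by auto
          ultimately show "\<bar>en n x - E x0\<bar> < 2 * h" by linarith
        qed
      qed
      have "eventually (\<lambda>n. \<exists>x\<in>{s..t}. u n x = 0) sequentially"
      proof (rule zeros_where_energy_nonzero[OF st h])
        show "eventually (\<lambda>n. \<forall>x\<in>{s..t}. h \<le> en n x) sequentially \<or>
          eventually (\<lambda>n. \<forall>x\<in>{s..t}. en n x \<le> - h) sequentially"
        proof (cases "0 < E x0")
          case True
          then have "E x0 = 4 * h" by (simp add: h_def)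
          with close h have "eventually (\<lambda>n. \<forall>x\<in>{s..t}. h \<le> en n x) sequentially"
            by (elim eventually_mono) (auto simp: abs_less_iff dest!: bspec)
          then show ?thesis ..
        next
          case False
          then have "E x0 = - 4 * h" by (simp add: h_def)
          with close h have "eventually (\<lambda>n. \<forall>x\<in>{s..t}. en n x \<le> - h) sequentially"
            by (elim eventually_mono) (auto simp: abs_less_iff dest!: bspec)
          then show ?thesis ..
        qed
      qed
      with eventually_ge_at_top[of N] have "eventually (\<lambda>n. N \<le> n \<and> (\<exists>x\<in>{s..t}. u n x = 0)) sequentially"
        by (rule eventually_conj)
      from eventually_happens'[OF sequentially_bot this]
      obtain n x where "N \<le> n" "x \<in> {s..t}" "u n x = 0" by blast
      then show "\<exists>y\<in>\<Union>j\<in>{N..}. {x \<in> {0..1}. u j x = 0}. dist y x0 < \<delta>"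
        using near[of x] r st by (intro bexI[of _ x]) (auto simp: dist_real_def)
    qed
    then show "x0 \<in> zero_accumulations u" by (simp add: zero_accumulations_def)
  qed
  moreover have "closed (zero_accumulations u)" by (auto simp: zero_accumulations_def)
  ultimately have "supp E \<subseteq> zero_accumulations u" unfolding supp_def by (rule closure_minimal)
  moreover have "x0 \<in> supp E \<union> {x \<in> {0..1}. da x = 0} \<union> {0, 1}" if x0: "x0 \<in> zero_accumulations u" for x0
  proof (rule ccontr)
    assume not: "x0 \<notin> supp E \<union> {x \<in> {0..1}. da x = 0} \<union> {0, 1}"
    have acc: "x0 \<in> closure (\<Union>j\<in>{N..}. {x \<in> {0..1}. u j x = 0})" for N
      using x0 by (simp add: zero_accumulations_def)
    have "closure (\<Union>j\<in>{0..}. {x \<in> {0..1}. u j x = 0}) \<subseteq> {0..1}"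
      by (intro closure_minimal) auto
    then have "x0 \<in> {0..1}" using acc[of 0] by blast
    with not have x01: "0 < x0" "x0 < 1" and dx0: "da x0 \<noteq> 0" and nE: "x0 \<notin> supp E" by auto
    define \<sigma> where "\<sigma> = sgn (da x0)"
    define m0 where "m0 = \<bar>da x0\<bar> / 2"
    have \<sigma>: "\<bar>\<sigma>\<bar> = 1" and m0: "0 < m0" using dx0 by (auto simp: \<sigma>_def m0_def sgn_if)
    have "open (- supp E)" by (simp add: supp_def open_Compl)
    then obtain d1 where d1: "0 < d1" "\<And>x. \<bar>x - x0\<bar> < d1 \<Longrightarrow> x \<notin> supp E"
      using nE by (auto simp: open_dist dist_real_def)
    have cda: "continuous_on {0..1} da" using assms(2) by (simp add: C1_on_def)
    obtain d2 where d2: "0 < d2" "\<And>x. x \<in> {0..1} \<Longrightarrow> \<bar>x - x0\<bar> < d2 \<Longrightarrow> \<bar>da x - da x0\<bar> < m0"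
      using cda[unfolded continuous_on_iff, rule_format, OF \<open>x0 \<in> {0..1}\<close> m0]
      by (auto simp: dist_real_def)
    define r where "r = Min {d1 / 2, d2 / 2, x0, 1 - x0}"
    have r: "0 < r" "r < d1" "r < d2" "r \<le> x0" "r \<le> 1 - x0"
      using d1 d2 x01 by (auto simp: r_def min_def)
    have sub: "{x0 - r..x0 + r} \<subseteq> {0..1}" using r by auto
    have weight: "m0 \<le> \<sigma> * da x" if x: "x \<in> {x0 - r..x0 + r}" for x
    proof -
      have "\<bar>da x - da x0\<bar> < m0" using d2(2)[of x] x sub r by (auto simp: abs_less_iff)
      then have "- m0 < da x - da x0" "da x - da x0 < m0" by linarith+
      then show ?thesis using dx0 by (cases "0 < da x0") (simp_all add: \<sigma>_def m0_def)
    qed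
    have small: "eventually (\<lambda>n. \<forall>x\<in>{x0 - r..x0 + r}. \<bar>en n x\<bar> < h) sequentially" if "0 < h" for h
      using conv[OF that]
    proof eventually_elim
      case (elim n)
      show ?case
      proof
        fix x assume x: "x \<in> {x0 - r..x0 + r}"
        then have "x \<notin> supp E" using d1(2)[of x] r by (auto simp: abs_less_iff)
        then have "E x = 0" using x sub closure_subset[of "{x \<in> {0..1}. E x \<noteq> 0}"]
          unfolding supp_def by blast
        moreover have "x \<in> {0..1}" using x sub by blast
        ultimately show "\<bar>en n x\<bar> < h" using bspec[OF elim] by (fastforce simp: dist_real_def)
      qed
    qed
    have "eventually (\<lambda>n. \<forall>z\<in>{x0 - r + 2 * (r / 4)..x0 + r - 2 * (r / 4)}. u n z \<noteq> 0) sequentially"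
      by (rule no_zeros_where_weight_monotone[OF sub _ \<sigma> m0 weight small]) (use r in auto)
    then obtain N where N: "\<And>n. N \<le> n \<Longrightarrow> \<forall>z\<in>{x0 - r + 2 * (r / 4)..x0 + r - 2 * (r / 4)}. u n z \<noteq> 0"
      unfolding eventually_sequentially by blast
    have "0 < r / 2" using r by simp
    with acc[of N] obtain w where w: "w \<in> (\<Union>j\<in>{N..}. {x \<in> {0..1}. u j x = 0})" "dist w x0 < r / 2"
      unfolding closure_approachable by blast
    then obtain j where "N \<le> j" "u j w = 0" by blast
    moreover have "w \<in> {x0 - r + 2 * (r / 4)..x0 + r - 2 * (r / 4)}"
    proof -
      have "\<bar>w - x0\<bar> < r / 2" using w(2) by (simp add: dist_real_def)
      then have "- (r / 2) < w - x0" "w - x0 < r / 2" by linarith+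
      then show ?thesis by simp
    qed
    ultimately show False using N by blast
  qed
  ultimately show ?thesis by blast
qed

end
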